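(* Let $A$ be an invariant algebra on a compact Hausdorff group $G$. The set $\mathcal{I}_A$ of idempotents of the semigroup $\mathcal{M}_A$, with its natural order, is a complete lattice; moreover, $\sup I$ and $\inf I$ are well-defined for each subset $I\subseteq\mathcal{I}_A$. In particular, $\mathcal{I}_A$ contains a least idempotent $\epsilon$, and $\epsilon$ belongs to the centre $Z(\mathcal{M}_A)$ of $\mathcal{M}_A$.
   Context: $C(G)$ is the Banach algebra of continuous complex functions on $G$ with the sup-norm. An invariant algebra on $G$ is a closed subalgebra of $C(G)$ that contains the constants and is invariant under all left and right translations. $\mathcal{M}_A$ is the set of all nonzero multiplicative linear functionals on $A$ with the weak-* topology; it is a compact semigroup under convolution: $(\varphi\psi)(f)=\int_{G\times G}f(gh)\,d\mu(g)\,d\nu(h)$ for any finite regular Borel complex measures $\mu,\nu$ on $G$ extending $\varphi,\psi$ to $C(G)$ (independent of the choice). $\mathcal{I}_A=\{j\in\mathcal{M}_A: jj=j\}$, ordered by: $j\leq k$ if and only if $jk=kj=j$. An ordered set is called a complete lattice if each of its bounded subsets $I$ has a least upper bound $\sup I$ and a greatest lower bound $\inf I$. *)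

theory Defs
  imports "HOL-Analysis.Analysis" "HOL-Algebra.Order"
begin

text \<open>
  The group is the type \<open>'g :: {topological_group_add, t2_space}\<close>. The class
  \<open>topological_group_add\<close> does not assume commutativity, so \<open>g + h\<close> is the product \<open>gh\<close> of an
  arbitrary (in general non-abelian) group written additively, and \<open>0\<close> is its identity.
  Compactness is the assumption \<open>compact (UNIV :: 'g set)\<close>.
\<close>

section \<open>Finite complex Borel measures\<close>

text \<open>Countable additivity with values in \<open>complex\<close> already forces finiteness and \<open>\<mu> {} = 0\<close>.\<close>

definition complex_borel_measure :: "('a::topological_space set \<Rightarrow> complex) \<Rightarrow> bool" where
  "complex_borel_measure \<mu> \<longleftrightarrow>
     (\<forall>E. range E \<subseteq> sets borel \<and> disjoint_family E \<longrightarrow>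
        (\<lambda>i::nat. \<mu> (E i)) sums \<mu> (\<Union>i. E i))"

definition total_variation :: "('a::topological_space set \<Rightarrow> complex) \<Rightarrow> 'a set \<Rightarrow> ennreal" where
  "total_variation \<mu> E =
     (SUP P\<in>{P. finite P \<and> disjoint P \<and> P \<subseteq> sets borel \<and> \<Union>P \<subseteq> E}.
        \<Sum>B\<in>P. ennreal (cmod (\<mu> B)))"

definition regular_complex_measure :: "('a::topological_space set \<Rightarrow> complex) \<Rightarrow> bool" where
  "regular_complex_measure \<mu> \<longleftrightarrow>
     complex_borel_measure \<mu> \<and>
     (\<forall>E\<in>sets borel. \<forall>e>0. \<exists>K U. compact K \<and> open U \<and> K \<subseteq> E \<and> E \<subseteq> U \<and>
        total_variation \<mu> (U - K) < e)"

text \<open>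
  \<open>positive_variation r\<close> is the positive part \<open>r\<^sup>+\<close> in the Jordan decomposition \<open>r = r\<^sup>+ - r\<^sup>-\<close> of a
  signed measure \<open>r\<close>, and \<open>r\<^sup>- = (-r)\<^sup>+\<close>. Negative values \<open>r B\<close> are sent to \<open>0\<close> by \<open>ennreal\<close>, which
  does not change the supremum because \<open>B = {}\<close> is allowed.
\<close>

definition positive_variation :: "('a::topological_space set \<Rightarrow> real) \<Rightarrow> 'a measure" where
  "positive_variation r =
     measure_of UNIV (sets borel) (\<lambda>E. SUP B\<in>{B\<in>sets borel. B \<subseteq> E}. ennreal (r B))"

definition signed_integral :: "('a::topological_space set \<Rightarrow> real) \<Rightarrow> ('a \<Rightarrow> complex) \<Rightarrow> complex" where
  "signed_integral r f =
     integral\<^sup>L (positive_variation r) f - integral\<^sup>L (positive_variation (\<lambda>E. - r E)) f"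

definition complex_integral :: "('a::topological_space set \<Rightarrow> complex) \<Rightarrow> ('a \<Rightarrow> complex) \<Rightarrow> complex" where
  "complex_integral \<mu> f =
     signed_integral (\<lambda>E. Re (\<mu> E)) f + \<i> * signed_integral (\<lambda>E. Im (\<mu> E)) f"

section \<open>Invariant algebras\<close>

text \<open>
  On a compact space every continuous function is bounded, so \<open>'g \<Rightarrow>\<^sub>C complex\<close> is \<open>C(G)\<close> with the
  sup-norm; the last conjunct is closedness in that norm.
\<close>

definition invariant_algebra :: "('g::topological_group_add \<Rightarrow> complex) set \<Rightarrow> bool" where
  "invariant_algebra A \<longleftrightarrow>
     (\<forall>f\<in>A. continuous_on UNIV f) \<and>
     (\<forall>c. (\<lambda>x. c) \<in> A) \<and>
     (\<forall>f\<in>A. \<forall>g\<in>A. (\<lambda>x. f x + g x) \<in> A) \<and>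
     (\<forall>f\<in>A. \<forall>g\<in>A. (\<lambda>x. f x * g x) \<in> A) \<and>
     (\<forall>c. \<forall>f\<in>A. (\<lambda>x. c * f x) \<in> A) \<and>
     (\<forall>a. \<forall>f\<in>A. (\<lambda>x. f (a + x)) \<in> A) \<and>
     (\<forall>a. \<forall>f\<in>A. (\<lambda>x. f (x + a)) \<in> A) \<and>
     closed {F :: 'g \<Rightarrow>\<^sub>C complex. apply_bcontfun F \<in> A}"

section \<open>The semigroup of multiplicative functionals\<close>

text \<open>
  A functional on \<open>A\<close> is a function that is \<open>undefined\<close> off \<open>A\<close> (\<open>extensional A\<close>), so that equality
  of HOL functions is equality of functionals on \<open>A\<close>.
\<close>

definition mult_functionals ::
  "('g::topological_group_add \<Rightarrow> complex) set \<Rightarrow> (('g \<Rightarrow> complex) \<Rightarrow> complex) set" where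
  "mult_functionals A =
     {\<phi> \<in> extensional A.
        (\<forall>f\<in>A. \<forall>g\<in>A. \<phi> (\<lambda>x. f x + g x) = \<phi> f + \<phi> g) \<and>
        (\<forall>c. \<forall>f\<in>A. \<phi> (\<lambda>x. c * f x) = c * \<phi> f) \<and>
        (\<forall>f\<in>A. \<forall>g\<in>A. \<phi> (\<lambda>x. f x * g x) = \<phi> f * \<phi> g) \<and>
        (\<exists>f\<in>A. \<phi> f \<noteq> 0)}"

definition extending_measure ::
  "('g::topological_group_add \<Rightarrow> complex) set \<Rightarrow> (('g \<Rightarrow> complex) \<Rightarrow> complex) \<Rightarrow>
    ('g set \<Rightarrow> complex) \<Rightarrow> bool" where
  "extending_measure A \<phi> \<mu> \<longleftrightarrow>
     regular_complex_measure \<mu> \<and> (\<forall>f\<in>A. complex_integral \<mu> f = \<phi> f)"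

text \<open>
  The value is the one obtained from \<^emph>\<open>every\<close> choice of extending measures \<open>\<mu>\<close> of \<open>\<phi>\<close> and \<open>\<nu>\<close> of \<open>\<psi>\<close>;
  the double integral is the iterated integral in the order \<open>d\<mu>(g) d\<nu>(h)\<close>.
\<close>

definition convolution ::
  "('g::topological_group_add \<Rightarrow> complex) set \<Rightarrow> (('g \<Rightarrow> complex) \<Rightarrow> complex) \<Rightarrow>
    (('g \<Rightarrow> complex) \<Rightarrow> complex) \<Rightarrow> (('g \<Rightarrow> complex) \<Rightarrow> complex)" where
  "convolution A \<phi> \<psi> =
     (\<lambda>f\<in>A. THE z. \<forall>\<mu> \<nu>. extending_measure A \<phi> \<mu> \<and> extending_measure A \<psi> \<nu> \<longrightarrow>
        z = complex_integral \<nu> (\<lambda>h. complex_integral \<mu> (\<lambda>g. f (g + h))))"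

definition semigroup_centre ::
  "('g::topological_group_add \<Rightarrow> complex) set \<Rightarrow> (('g \<Rightarrow> complex) \<Rightarrow> complex) set" where
  "semigroup_centre A =
     {\<zeta> \<in> mult_functionals A. \<forall>\<phi>\<in>mult_functionals A. convolution A \<zeta> \<phi> = convolution A \<phi> \<zeta>}"

definition idempotents ::
  "('g::topological_group_add \<Rightarrow> complex) set \<Rightarrow> (('g \<Rightarrow> complex) \<Rightarrow> complex) set" where
  "idempotents A = {j \<in> mult_functionals A. convolution A j j = j}"

definition idempotent_order ::
  "('g::topological_group_add \<Rightarrow> complex) set \<Rightarrow> (('g \<Rightarrow> complex) \<Rightarrow> complex) gorder" where
  "idempotent_order A =
     \<lparr>carrier = idempotents A, eq = (=),
      le = (\<lambda>j k. convolution A j k = j \<and> convolution A k j = j)\<rparr>"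

section \<open>Complete lattices\<close>

text \<open>
  This is weaker than the locale \<open>complete_lattice\<close> of HOL-Algebra, which requires suprema and
  infima of all subsets of the carrier, not only of the bounded ones.
\<close>

definition bounded_complete_lattice :: "('a, 'b) gorder_scheme \<Rightarrow> bool" where
  "bounded_complete_lattice L \<longleftrightarrow>
     partial_order L \<and>
     (\<forall>I\<subseteq>carrier L. Upper L I \<noteq> {} \<and> Lower L I \<noteq> {} \<longrightarrow>
        (\<exists>s. least L s (Upper L I)) \<and> (\<exists>i. greatest L i (Lower L I)))"

end

theory Submission
  imports Defs "HOL-Probability.Probability_Measure"
begin

text \<open>
  A functional \<open>\<phi> \<in> M\<^sub>A\<close> satisfies \<open>\<bar>\<phi> f\<bar> \<le> \<parallel>f\<parallel>\<close> and \<open>\<phi> 1 = 1\<close>, so by Hahn--Banach and Riesz it is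
  integration against a regular probability measure; hence the product is
  \<open>(\<phi>\<psi>) f = \<psi> (h \<mapsto> \<phi> (g \<mapsto> f (g h)))\<close>. The key step is a maximum principle: if \<open>\<phi>x = x\<close>, then
  \<open>F h = x (g \<mapsto> f (h g))\<close> has the mean value property \<open>F h = \<integral> F (h s) d\<phi>(s)\<close>, and since a closed
  subsemigroup of a compact group is a group, \<open>F\<close> is invariant under the support of \<open>\<phi>\<close>, that is,
  \<open>\<delta>\<^sub>s x = x\<close> for every \<open>s\<close> in that support.

  Let \<open>x\<close> lie in a minimal closed left ideal of the closed semigroup \<open>S\<close> generated by a set \<open>I\<close> of
  idempotents. For \<open>j \<in> I\<close> there is \<open>t \<in> S\<close> with \<open>x = t j x\<close>, so \<open>\<delta>\<^sub>a \<delta>\<^sub>s x = x\<close> for \<open>a\<close>, \<open>s\<close> in the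
  supports of \<open>t\<close>, \<open>j\<close>. Thus \<open>\<delta>\<^sub>s x\<close> does not depend on \<open>s\<close>, which forces \<open>j x = x\<close>; a similar
  argument gives \<open>x j = x\<close>. So \<open>x\<close> is an idempotent and the infimum of \<open>I\<close>; suprema are infima of
  upper bounds. The least idempotent is fixed by all conjugations \<open>\<delta>\<^sub>g (\<cdot>) \<delta>\<^sub>g\<^sup>-\<^sup>1\<close>, hence commutes with
  every \<open>\<delta>\<^sub>g\<close> and, by averaging, with every functional.
\<close>

section \<open>The Riesz measure of a state on a compact Hausdorff space\<close>

lemma Hausdorff_space_euclidean: "Hausdorff_space (euclidean :: 'a::t2_space topology)"
  unfolding Hausdorff_space_def disjnt_def by (metis hausdorff open_openin)

lemma compact_UNIV_bounded:
  fixes u :: "'a::topological_space \<Rightarrow> 'b::real_normed_vector"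
  assumes "compact (UNIV :: 'a set)" "continuous_on UNIV u"
  shows "\<exists>C>0. \<forall>x. norm (u x) \<le> C"
proof -
  have "bounded (range u)"
    using compact_continuous_image[OF assms(2,1)] by (rule compact_imp_bounded)
  then show ?thesis by (auto simp: bounded_pos)
qed

lemma Urysohn_compact_t2:
  fixes S T :: "'a::t2_space set"
  assumes "compact (UNIV :: 'a set)" "closed S" "closed T" "S \<inter> T = {}"
  obtains u :: "'a \<Rightarrow> real" where "continuous_on UNIV u" "\<And>x. 0 \<le> u x" "\<And>x. u x \<le> 1"
    "\<And>x. x \<in> S \<Longrightarrow> u x = 0" "\<And>x. x \<in> T \<Longrightarrow> u x = 1"
proof -
  have "compact_space (euclidean :: 'a topology)"
    using assms(1) by (simp add: compact_space_def)
  then have "normal_space (euclidean :: 'a topology)"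
    using compact_Hausdorff_or_regular_imp_normal_space Hausdorff_space_euclidean by blast
  then obtain f where f: "continuous_map (euclidean :: 'a topology) (top_of_set {0..1::real}) f"
    "f ` S \<subseteq> {0}" "f ` T \<subseteq> {1}"
    using Urysohn_lemma[of "euclidean :: 'a topology" S T 0 1] assms(2-)
    by (auto simp: disjnt_def)
  have "continuous_on UNIV f" "f ` UNIV \<subseteq> {0..1}"
    using f(1) by (auto simp: continuous_map_in_subtopology)
  then show ?thesis
    using that[of f] f(2,3) by (auto simp: image_subset_iff)
qed

text \<open>The object of the Riesz theorem: a normalised positive functional on the real continuous
  functions. \<open>\<Lambda>\<close> is a total HOL function, so the axioms speak of continuous
  arguments and its other values stay arbitrary.\<close>

locale state =
  fixes \<Lambda> :: "('a::t2_space \<Rightarrow> real) \<Rightarrow> real"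
  assumes compact_UNIV: "compact (UNIV :: 'a set)"
    and add: "continuous_on UNIV u \<Longrightarrow> continuous_on UNIV v \<Longrightarrow> \<Lambda> (\<lambda>x. u x + v x) = \<Lambda> u + \<Lambda> v"
    and scale: "continuous_on UNIV u \<Longrightarrow> \<Lambda> (\<lambda>x. c * u x) = c * \<Lambda> u"
    and nonneg: "continuous_on UNIV u \<Longrightarrow> (\<And>x. 0 \<le> u x) \<Longrightarrow> 0 \<le> \<Lambda> u"
    and one: "\<Lambda> (\<lambda>x. 1) = 1"
begin

lemma const: "\<Lambda> (\<lambda>x. c) = c"
  using scale[of "\<lambda>x. 1" c] one by simp

lemma minus: "continuous_on UNIV u \<Longrightarrow> \<Lambda> (\<lambda>x. - u x) = - \<Lambda> u"
  using scale[of u "-1"] by simp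

lemma diff:
  assumes "continuous_on UNIV u" "continuous_on UNIV v"
  shows "\<Lambda> (\<lambda>x. u x - v x) = \<Lambda> u - \<Lambda> v"
  using add[of u "\<lambda>x. - v x"] assms minus[of v] by (simp add: continuous_on_minus)

lemma mono:
  assumes "continuous_on UNIV u" "continuous_on UNIV v" "\<And>x. u x \<le> v x"
  shows "\<Lambda> u \<le> \<Lambda> v"
  using nonneg[of "\<lambda>x. v x - u x"] diff[of v u] assms by (simp add: continuous_on_diff)

lemma sum:
  assumes "finite I" "\<And>i. i \<in> I \<Longrightarrow> continuous_on UNIV (u i)"
  shows "\<Lambda> (\<lambda>x. \<Sum>i\<in>I. u i x) = (\<Sum>i\<in>I. \<Lambda> (u i))"
  using assms
proof (induction I rule: finite_induct)
  case empty
  then show ?case by (simp add: const)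
next
  case (insert i I)
  then show ?case
    using add[of "u i" "\<lambda>x. \<Sum>i\<in>I. u i x"] by (simp add: continuous_on_sum)
qed

section \<open>The outer mass defined by a state\<close>

definition below :: "'a set \<Rightarrow> ('a \<Rightarrow> real) set" where
  "below U = {u. continuous_on UNIV u \<and> (\<forall>x. 0 \<le> u x \<and> u x \<le> 1) \<and> (\<forall>x. x \<notin> U \<longrightarrow> u x = 0)}"

text \<open>The competitors only vanish off \<open>U\<close>; the compact support inside
  \<open>U\<close> demanded by the classical construction is recovered through
  \<open>cutoff\<close>, up to an arbitrarily small error.\<close>

definition open_mass :: "'a set \<Rightarrow> real" where
  "open_mass U = (SUP u\<in>below U. \<Lambda> u)"

definition outer_mass :: "'a set \<Rightarrow> real" where
  "outer_mass E = (INF U\<in>{U. open U \<and> E \<subseteq> U}. open_mass U)"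

lemma below_bounds:
  assumes "u \<in> below U"
  shows "0 \<le> \<Lambda> u" "\<Lambda> u \<le> 1"
  using assms nonneg[of u] mono[of u "\<lambda>x. 1"] one by (auto simp: below_def)

lemma bdd_above_below: "bdd_above (\<Lambda> ` below U)"
  using below_bounds by (auto intro!: bdd_aboveI[of _ 1])

lemma zero_in_below: "(\<lambda>x. 0) \<in> below U"
  by (auto simp: below_def)

lemma le_open_mass: "u \<in> below U \<Longrightarrow> \<Lambda> u \<le> open_mass U"
  unfolding open_mass_def by (rule cSUP_upper[OF _ bdd_above_below])

lemma open_mass_le: "(\<And>u. u \<in> below U \<Longrightarrow> \<Lambda> u \<le> c) \<Longrightarrow> open_mass U \<le> c"
  unfolding open_mass_def using zero_in_below by (intro cSUP_least) auto

lemma open_mass_nonneg: "0 \<le> open_mass U"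
  using le_open_mass[OF zero_in_below, of U] const[of 0] by simp

lemma open_mass_mono: "U \<subseteq> V \<Longrightarrow> open_mass U \<le> open_mass V"
  by (rule open_mass_le, rule le_open_mass) (auto simp: below_def)

lemma open_mass_empty: "open_mass {} \<le> 0"
proof (rule open_mass_le)
  fix u assume "u \<in> below {}"
  then have "u = (\<lambda>x. 0)" by (auto simp: below_def)
  then show "\<Lambda> u \<le> 0" using const[of 0] by simp
qed

lemma open_mass_UNIV: "open_mass UNIV = 1"
proof (rule antisym)
  show "open_mass UNIV \<le> 1" using below_bounds by (blast intro: open_mass_le)
  have "(\<lambda>x. 1) \<in> below UNIV" by (auto simp: below_def)
  from le_open_mass[OF this] show "1 \<le> open_mass UNIV" by (simp add: one)
qed

text \<open>Cutting off at height \<open>e\<close> makes the support compact at a cost of at most \<open>e\<close>.\<close>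

lemma cutoff:
  assumes "continuous_on UNIV u" "0 \<le> e"
  shows "\<Lambda> u \<le> e + \<Lambda> (\<lambda>x. max (u x - e) 0)"
proof -
  have "\<Lambda> u \<le> \<Lambda> (\<lambda>x. e + max (u x - e) 0)"
    by (intro mono continuous_intros assms) auto
  also have "\<dots> = e + \<Lambda> (\<lambda>x. max (u x - e) 0)"
    by (subst add) (auto intro!: continuous_intros assms simp: const)
  finally show ?thesis .
qed

lemma cutoff_below:
  assumes "u \<in> below U" "0 \<le> e" "{x. e \<le> u x} \<subseteq> V"
  shows "(\<lambda>x. max (u x - e) 0) \<in> below V"
proof -
  have "max (u x - e) 0 \<le> 1" for x
    using assms(1,2) by (auto simp: below_def max_def intro: order_trans[of _ "u x"])
  moreover have "max (u x - e) 0 = 0" if "x \<notin> V" for x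
    using that assms(3) by (auto simp: max_def not_le dest: less_imp_le)
  ultimately show ?thesis
    using assms(1) by (auto simp: below_def intro!: continuous_intros)
qed

text \<open>A competitor \<open>f\<close>, cut off to \<open>g\<close>, splits as
  \<open>w g + (1 - w) g\<close>, where Urysohn's \<open>w\<close> vanishes off \<open>U\<close> and
  equals 1 on the part of \<open>K\<close> outside \<open>V\<close>; the summands compete for
  \<open>U\<close> and for \<open>V\<close>.\<close>

lemma open_mass_Un:
  assumes U: "open U" and V: "open V"
  shows "open_mass (U \<union> V) \<le> open_mass U + open_mass V"
proof (rule open_mass_le)
  fix f assume f: "f \<in> below (U \<union> V)"
  then have cf: "continuous_on UNIV f" by (auto simp: below_def)
  show "\<Lambda> f \<le> open_mass U + open_mass V"
  proof (rule field_le_epsilon)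
    fix e :: real assume e: "0 < e"
    define K where "K = {x. e \<le> f x}"
    have K: "closed K"
      unfolding K_def using cf by (intro closed_Collect_le continuous_intros)
    \<comment> \<open>On \<open>K\<close> the function \<open>f\<close> is at least
      \<open>e\<close>, hence nonzero, so \<open>K\<close> lies in the union and the two closed sets
      to be separated are disjoint.\<close>
    have "- U \<inter> (K - V) = {}" using f e by (force simp: K_def below_def)
    moreover have "closed (- U)" "closed (K - V)" using K U V by (auto simp: closed_Diff)
    ultimately obtain w :: "'a \<Rightarrow> real" where w: "continuous_on UNIV w" "\<And>x. 0 \<le> w x" "\<And>x. w x \<le> 1"
      "\<And>x. x \<in> - U \<Longrightarrow> w x = 0" "\<And>x. x \<in> K - V \<Longrightarrow> w x = 1"
      using Urysohn_compact_t2[OF compact_UNIV, of "- U" "K - V"] by blast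
    define g where "g = (\<lambda>x. max (f x - e) 0)"
    have "g \<in> below K"
      unfolding g_def by (rule cutoff_below[OF f]) (use e in \<open>auto simp: K_def\<close>)
    then have g: "continuous_on UNIV g" "\<And>x. 0 \<le> g x" "\<And>x. g x \<le> 1" "\<And>x. x \<notin> K \<Longrightarrow> g x = 0"
      by (auto simp: below_def)
    have "w x * g x \<le> 1" "(1 - w x) * g x \<le> 1" for x
      using w(2,3)[of x] g(2,3)[of x] by (auto intro!: mult_le_one)
    moreover have "w x * g x = 0" if "x \<notin> U" for x using w(4) that by auto
    moreover have "(1 - w x) * g x = 0" if "x \<notin> V" for x
      using w(5)[of x] g(4)[of x] that by auto
    ultimately have "(\<lambda>x. w x * g x) \<in> below U" "(\<lambda>x. (1 - w x) * g x) \<in> below V"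
      using w(1-3) g(1-3) by (auto simp: below_def intro!: continuous_intros)
    then have "\<Lambda> (\<lambda>x. w x * g x) \<le> open_mass U" "\<Lambda> (\<lambda>x. (1 - w x) * g x) \<le> open_mass V"
      by (auto intro: le_open_mass)
    moreover have "\<Lambda> g = \<Lambda> (\<lambda>x. w x * g x) + \<Lambda> (\<lambda>x. (1 - w x) * g x)"
      by (subst add[symmetric]) (auto intro!: continuous_intros w g simp: algebra_simps)
    moreover have "\<Lambda> f \<le> e + \<Lambda> g"
      unfolding g_def using cutoff[OF cf] e by simp
    ultimately show "\<Lambda> f \<le> open_mass U + open_mass V + e" by simp
  qed
qed

lemma open_mass_UN_finite:
  assumes "finite I" "\<And>i. i \<in> I \<Longrightarrow> open (U i)"
  shows "open_mass (\<Union>i\<in>I. U i) \<le> (\<Sum>i\<in>I. open_mass (U i))"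
  using assms
proof (induction I rule: finite_induct)
  case empty
  then show ?case using open_mass_empty by simp
next
  case (insert i I)
  have "open_mass (U i \<union> (\<Union>i\<in>I. U i)) \<le> open_mass (U i) + open_mass (\<Union>i\<in>I. U i)"
    using insert by (intro open_mass_Un) auto
  with insert show ?case by simp
qed

text \<open>The series may diverge, hence \<open>ennreal\<close>. A near-optimal \<open>f\<close> is
  at least \<open>e / 2\<close> only on a compact set, which finitely many \<open>U i\<close> cover.
  One \<open>e / 2\<close> pays for the choice of \<open>f\<close>, the other for the
  cutoff.\<close>

lemma open_mass_UN:
  fixes U :: "nat \<Rightarrow> 'a set"
  assumes "\<And>i. open (U i)"
  shows "ennreal (open_mass (\<Union>i. U i)) \<le> (\<Sum>i. ennreal (open_mass (U i)))"
proof (rule ennreal_le_epsilon)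
  fix e :: real assume e: "0 < e"
  have "\<exists>f\<in>below (\<Union>i. U i). open_mass (\<Union>i. U i) - e / 2 < \<Lambda> f"
    using less_cSUP_iff[OF _ bdd_above_below, of "\<Union>i. U i" "open_mass (\<Union>i. U i) - e / 2"]
      zero_in_below e by (auto simp: open_mass_def)
  then obtain f where f: "f \<in> below (\<Union>i. U i)" "open_mass (\<Union>i. U i) - e / 2 < \<Lambda> f" by blast
  then have cf: "continuous_on UNIV f" by (auto simp: below_def)
  define K where "K = {x. e / 2 \<le> f x}"
  have "closed K"
    unfolding K_def using cf by (intro closed_Collect_le continuous_intros)
  then have "compact K" using compact_UNIV closed_Int_compact[of K UNIV] by simp
  moreover have "K \<subseteq> (\<Union>i. U i)"
  proof
    fix x assume "x \<in> K"
    then have "f x \<noteq> 0" using e by (auto simp: K_def)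
    then show "x \<in> (\<Union>i. U i)" using f by (auto simp: below_def)
  qed
  ultimately obtain I where I: "finite I" "K \<subseteq> (\<Union>i\<in>I. U i)"
    using compactE_image[of K UNIV U] assms by auto
  have "(\<lambda>x. max (f x - e / 2) 0) \<in> below (\<Union>i\<in>I. U i)"
    by (rule cutoff_below[OF f(1)]) (use e I(2) in \<open>auto simp: K_def\<close>)
  then have "\<Lambda> (\<lambda>x. max (f x - e / 2) 0) \<le> (\<Sum>i\<in>I. open_mass (U i))"
    using le_open_mass open_mass_UN_finite[OF I(1), of U] assms by force
  then have "open_mass (\<Union>i. U i) \<le> (\<Sum>i\<in>I. open_mass (U i)) + e"
    using cutoff[OF cf, of "e / 2"] f(2) e by simp
  then have "ennreal (open_mass (\<Union>i. U i)) \<le> (\<Sum>i\<in>I. ennreal (open_mass (U i))) + ennreal e"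
    using e by (simp add: open_mass_nonneg sum_nonneg ennreal_leI flip: ennreal_plus)
  also have "\<dots> \<le> (\<Sum>i. ennreal (open_mass (U i))) + ennreal e"
    by (intro add_right_mono sum_le_suminf) (auto simp: I)
  finally show "ennreal (open_mass (\<Union>i. U i)) \<le> (\<Sum>i. ennreal (open_mass (U i))) + ennreal e" .
qed

lemma bdd_outer_mass: "bdd_below (open_mass ` {U. open U \<and> E \<subseteq> U})"
  using open_mass_nonneg by (auto intro!: bdd_belowI[of _ 0])

lemma outer_mass_le: "open U \<Longrightarrow> E \<subseteq> U \<Longrightarrow> outer_mass E \<le> open_mass U"
  unfolding outer_mass_def using bdd_outer_mass by (auto intro: cINF_lower)

lemma outer_mass_ge: "(\<And>U. open U \<Longrightarrow> E \<subseteq> U \<Longrightarrow> c \<le> open_mass U) \<Longrightarrow> c \<le> outer_mass E"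
  unfolding outer_mass_def by (rule cINF_greatest) (auto intro: exI[of _ UNIV])

lemma outer_mass_approx:
  assumes "0 < e"
  obtains U where "open U" "E \<subseteq> U" "open_mass U < outer_mass E + e"
  using outer_mass_ge[of E "outer_mass E + e"] assms by force

lemma outer_mass_nonneg: "0 \<le> outer_mass E"
  by (rule outer_mass_ge) (rule open_mass_nonneg)

lemma outer_mass_open: "open U \<Longrightarrow> outer_mass U = open_mass U"
  by (intro antisym outer_mass_le outer_mass_ge open_mass_mono) auto

lemma outer_mass_mono: "E \<subseteq> F \<Longrightarrow> outer_mass E \<le> outer_mass F"
  by (rule outer_mass_ge, rule outer_mass_le) auto

text \<open>After the cutoff, \<open>f\<close> lives on a closed set \<open>K\<close> inside
  \<open>U\<close>. A competitor \<open>g\<close> for the open set \<open>V - K\<close> vanishes on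
  \<open>K\<close>, so the cut-off \<open>f\<close> plus \<open>g\<close> stays below 1 and competes
  for \<open>V\<close>.\<close>

lemma open_mass_split:
  assumes U: "open U" and V: "open V"
  shows "open_mass (V \<inter> U) + outer_mass (V - U) \<le> open_mass V"
proof -
  have "open_mass (V \<inter> U) \<le> open_mass V - outer_mass (V - U)"
  proof (rule open_mass_le)
    fix f assume f: "f \<in> below (V \<inter> U)"
    then have cf: "continuous_on UNIV f" by (auto simp: below_def)
    show "\<Lambda> f \<le> open_mass V - outer_mass (V - U)"
    proof (rule field_le_epsilon)
      fix e :: real assume e: "0 < e"
      define K where "K = {x. e \<le> f x}"
      have "closed K"
        unfolding K_def using cf by (intro closed_Collect_le continuous_intros)
      moreover have "K \<subseteq> U" using f e by (force simp: K_def below_def)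
      ultimately have "outer_mass (V - U) \<le> open_mass (V - K)"
        using V by (intro outer_mass_le) (auto simp: open_Diff)
      also have "\<dots> \<le> open_mass V - \<Lambda> (\<lambda>x. max (f x - e) 0)"
      proof (rule open_mass_le)
        fix g assume g: "g \<in> below (V - K)"
        then have cg: "continuous_on UNIV g" by (auto simp: below_def)
        have "max (f x - e) 0 + g x \<le> 1" for x
        proof (cases "x \<in> K")
          case True
          then have "g x = 0" using g by (auto simp: below_def)
          moreover have "f x \<le> 1" using f by (auto simp: below_def)
          ultimately show ?thesis using e by auto
        next
          case False
          then have "max (f x - e) 0 = 0" by (auto simp: K_def)
          then show ?thesis using g by (auto simp: below_def)
        qed
        moreover have "max (f x - e) 0 + g x = 0" if "x \<notin> V" for x
          using f g that e by (auto simp: below_def)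
        ultimately have "(\<lambda>x. max (f x - e) 0 + g x) \<in> below V"
          using g cf cg by (auto simp: below_def intro!: continuous_intros)
        from le_open_mass[OF this] show "\<Lambda> g \<le> open_mass V - \<Lambda> (\<lambda>x. max (f x - e) 0)"
          by (subst (asm) add) (auto intro!: continuous_intros cf cg)
      qed
      finally show "\<Lambda> f \<le> open_mass V - outer_mass (V - U) + e"
        using cutoff[OF cf, of e] e by simp
    qed
  qed
  then show ?thesis by simp
qed

lemma outer_mass_subadditive: 
  fixes E :: "nat \<Rightarrow> 'a set"
  shows "ennreal (outer_mass (\<Union>i. E i)) \<le> (\<Sum>i. ennreal (outer_mass (E i)))"
proof (rule ennreal_le_epsilon)
  fix e :: real assume e: "0 < e"
  have "\<exists>U. open U \<and> E i \<subseteq> U \<and> open_mass U < outer_mass (E i) + e * (1/2) ^ Suc i" for i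
    using outer_mass_approx[of "e * (1/2) ^ Suc i" "E i"] e by (metis mult_pos_pos zero_less_power half_gt_zero_iff zero_less_one)
  then obtain U where U: "\<And>i. open (U i)" "\<And>i. E i \<subseteq> U i"
    "\<And>i. open_mass (U i) < outer_mass (E i) + e * (1/2) ^ Suc i"
    by metis
  have "ennreal (outer_mass (\<Union>i. E i)) \<le> ennreal (open_mass (\<Union>i. U i))"
    using U by (intro ennreal_leI outer_mass_le) auto
  also have "\<dots> \<le> (\<Sum>i. ennreal (open_mass (U i)))"
    using U by (intro open_mass_UN)
  also have "\<dots> \<le> (\<Sum>i. ennreal (outer_mass (E i)) + ennreal (e * (1/2) ^ Suc i))"
  proof (intro suminf_le allI)
    fix i
    have "ennreal (open_mass (U i)) \<le> ennreal (outer_mass (E i) + e * (1/2) ^ Suc i)"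
      using U(3)[of i] by (intro ennreal_leI) simp
    also have "\<dots> = ennreal (outer_mass (E i)) + ennreal (e * (1/2) ^ Suc i)"
      using e outer_mass_nonneg by (intro ennreal_plus) auto
    finally show "ennreal (open_mass (U i)) \<le> ennreal (outer_mass (E i)) + ennreal (e * (1/2) ^ Suc i)" .
  qed auto
  also have "\<dots> = (\<Sum>i. ennreal (outer_mass (E i))) + (\<Sum>i. ennreal (e * (1/2) ^ Suc i))"
    by (intro suminf_add[symmetric]) auto
  also have "(\<Sum>i. ennreal (e * (1/2) ^ Suc i)) = ennreal e"
    using e sums_mult[OF power_half_series, of e] by (intro suminf_ennreal_eq) auto
  finally show "ennreal (outer_mass (\<Union>i. E i)) \<le> (\<Sum>i. ennreal (outer_mass (E i))) + ennreal e" .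
qed

lemma outer_mass_empty: "outer_mass {} = 0"
  using outer_mass_nonneg[of "{}"] outer_mass_open[of "{}"] open_mass_empty by simp

lemma outer_mass_Un: "outer_mass (E \<union> F) \<le> outer_mass E + outer_mass F"
proof -
  define X where "X = (\<lambda>i::nat. if i = 0 then E else if i = 1 then F else {})"
  have "(\<Union>i. X i) = E \<union> F" by (auto simp: X_def split: if_splits)
  moreover have "(\<Sum>i. ennreal (outer_mass (X i))) = (\<Sum>i\<in>{0,1}. ennreal (outer_mass (X i)))"
    by (rule suminf_finite) (auto simp: X_def outer_mass_empty)
  ultimately have "ennreal (outer_mass (E \<union> F)) \<le> ennreal (outer_mass E + outer_mass F)"
    using outer_mass_subadditive[of X] by (simp add: X_def ennreal_plus outer_mass_nonneg)
  then show ?thesis by (subst (asm) ennreal_le_iff) (simp_all add: outer_mass_nonneg)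
qed

text \<open>Caratheodory's criterion for open sets: \<open>open_mass_split\<close> passes from open
  test sets to an arbitrary \<open>T\<close> through the open supersets of \<open>T\<close>.\<close>

lemma outer_mass_measurable_open:
  assumes U: "open U"
  shows "outer_mass (T \<inter> U) + outer_mass (T - U) = outer_mass T"
proof (rule antisym)
  show "outer_mass (T \<inter> U) + outer_mass (T - U) \<le> outer_mass T"
  proof (rule outer_mass_ge)
    fix V assume V: "open V" "T \<subseteq> V"
    have "outer_mass (T \<inter> U) \<le> open_mass (V \<inter> U)" "outer_mass (T - U) \<le> outer_mass (V - U)"
      using U V by (auto intro!: outer_mass_le outer_mass_mono)
    then show "outer_mass (T \<inter> U) + outer_mass (T - U) \<le> open_mass V"
      using open_mass_split[OF U V(1)] by simp
  qed
  show "outer_mass T \<le> outer_mass (T \<inter> U) + outer_mass (T - U)"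
    using outer_mass_Un[of "T \<inter> U" "T - U"] by (simp add: Int_Diff_Un)
qed

section \<open>The Borel measure, its integral and its regularity\<close>

definition riesz_measure :: "'a measure" where
  "riesz_measure = measure_of UNIV (sets borel) (\<lambda>E. ennreal (outer_mass E))"

text \<open>Caratheodory's lambda-system is a sigma-algebra containing the open sets, hence the
  Borel sets, to which the measure is restricted.\<close>

lemma measure_space_outer_mass: "measure_space UNIV (sets borel) (\<lambda>E. ennreal (outer_mass E))"
proof -
  interpret P: sigma_algebra "UNIV :: 'a set" "Pow UNIV" by (rule sigma_algebra_Pow)
  let ?L = "lambda_system UNIV (Pow UNIV) (\<lambda>E. ennreal (outer_mass E))"
  have "outer_measure_space (Pow UNIV) (\<lambda>E. ennreal (outer_mass E))"
    using outer_mass_subadditive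
    by (auto simp: outer_measure_space_def positive_def increasing_def countably_subadditive_def
        outer_mass_empty intro!: ennreal_leI outer_mass_mono)
  then have ms: "measure_space UNIV ?L (\<lambda>E. ennreal (outer_mass E))"
    by (rule P.caratheodory_lemma)
  then have L: "sigma_algebra UNIV ?L" by (simp add: measure_space_def)
  have "U \<in> ?L" if "open U" for U
    using that unfolding P.lambda_system_eq
    by (auto simp: outer_mass_measurable_open outer_mass_nonneg simp flip: ennreal_plus)
  then have "{U. open U} \<subseteq> ?L" by blast
  then have "sets borel \<subseteq> ?L"
    unfolding borel_def using sigma_algebra.sigma_sets_subset[OF L] by (simp add: sets_measure_of_conv)
  moreover have "sigma_algebra UNIV (sets (borel :: 'a measure))"
    using sets.sigma_algebra_axioms[of "borel :: 'a measure"] by simp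
  ultimately show ?thesis using measure_down[OF ms] by blast
qed

lemma sets_riesz_measure [measurable_cong, simp]: "sets riesz_measure = sets borel"
  unfolding riesz_measure_def using sets.sigma_sets_eq[of "borel :: 'a measure"]
  by (simp add: sets_measure_of_conv)

lemma space_riesz_measure [simp]: "space riesz_measure = UNIV"
  by (simp add: riesz_measure_def space_measure_of_conv)

lemma emeasure_riesz_measure:
  assumes "E \<in> sets borel"
  shows "emeasure riesz_measure E = ennreal (outer_mass E)"
proof (rule emeasure_measure_of[OF riesz_measure_def])
  show "countably_additive (sets riesz_measure) (\<lambda>E. ennreal (outer_mass E))"
    "positive (sets riesz_measure) (\<lambda>E. ennreal (outer_mass E))"
    using measure_space_outer_mass by (auto simp: measure_space_def)
qed (use assms in auto)

lemma measure_riesz_measure: "E \<in> sets borel \<Longrightarrow> measure riesz_measure E = outer_mass E"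
  by (simp add: measure_def emeasure_riesz_measure outer_mass_nonneg)

lemma prob_space_riesz_measure: "prob_space riesz_measure"
  by (rule prob_spaceI) (simp add: emeasure_riesz_measure outer_mass_open open_mass_UNIV)

lemma integrable_riesz_measure:
  assumes "continuous_on UNIV (u :: 'a \<Rightarrow> real)"
  shows "integrable riesz_measure u"
proof -
  interpret M: prob_space riesz_measure by (rule prob_space_riesz_measure)
  obtain C where "\<And>x. norm (u x) \<le> C" using compact_UNIV_bounded[OF compact_UNIV assms] by blast
  then show ?thesis
    using borel_measurable_continuous_onI[OF assms] measurable_cong_sets[OF sets_riesz_measure refl]
    by (intro M.integrable_const_bound[of _ C]) auto
qed

text \<open>Slice \<open>u\<close> into \<open>n + 1\<close> layers; the mass of a superlevel set lies between \<open>n + 1\<close> times the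
  \<open>\<Lambda>\<close>-value of the layer above it and \<open>n + 1\<close> times the integral of the layer below it.\<close>

lemma le_integral_riesz_measure_layers:
  assumes u: "continuous_on UNIV u" "\<And>x. 0 \<le> u x" "\<And>x. u x \<le> 1"
  shows "\<Lambda> u \<le> 1 / real (Suc n) + (\<integral>x. u x \<partial>riesz_measure)"
proof -
  interpret M: prob_space riesz_measure by (rule prob_space_riesz_measure)
  define N where "N = real (Suc n)"
  have N: "N > 0" by (simp add: N_def)
  define c where "c k x = min (u x) (real (Suc k) / N) - min (u x) (real k / N)" for k :: nat and x
  have cc: "continuous_on UNIV (c k)" for k
    unfolding c_def by (intro continuous_intros u)
  have c_nonneg: "0 \<le> c k x" for k x
    using N by (simp add: c_def min.coboundedI2 divide_right_mono)
  have u_eq: "u x = (\<Sum>k<Suc n. c k x)" for x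
    unfolding c_def using u(2,3)[of x] N
    by (subst sum_lessThan_telescope) (simp add: N_def)
  have slice: "N * c k x \<le> 1" for k x
    using N by (auto simp: c_def min_def field_simps not_le)
  have c_zero: "c k x = 0" if "u x \<le> real k / N" for k x
  proof -
    have "real k / N \<le> real (Suc k) / N" using N by (simp add: divide_right_mono)
    then show ?thesis using that by (auto simp: c_def)
  qed
  have open_level: "open {x. t < u x}" for t
    using u(1) by (intro open_Collect_less continuous_intros)
  have upper: "\<Lambda> (c k) \<le> M.prob {x. real k / N < u x} / N" for k
  proof -
    have "(\<lambda>x. N * c k x) \<in> below {x. real k / N < u x}"
      using cc c_nonneg slice N c_zero by (auto simp: below_def not_less intro!: continuous_intros)
    from le_open_mass[OF this] have "N * \<Lambda> (c k) \<le> open_mass {x. real k / N < u x}"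
      using scale[OF cc] by simp
    also have "\<dots> = M.prob {x. real k / N < u x}"
      using open_level by (simp add: measure_riesz_measure outer_mass_open)
    finally show ?thesis using N by (simp add: pos_le_divide_eq mult.commute)
  qed
  have lower: "M.prob {x. real (Suc k) / N < u x} / N \<le> (\<integral>x. c k x \<partial>riesz_measure)" for k
  proof -
    have "(\<integral>x. indicator {x. real (Suc k) / N < u x} x / N \<partial>riesz_measure) \<le> (\<integral>x. c k x \<partial>riesz_measure)"
    proof (rule integral_mono)
      show "integrable riesz_measure (\<lambda>x. indicator {x. real (Suc k) / N < u x} x / N :: real)"
        using open_level
        by (intro integrable_divide integrable_real_indicator) (auto simp: emeasure_riesz_measure)
      fix x
      have "real k / N \<le> real (Suc k) / N" using N by (simp add: divide_right_mono)
      then show "indicator {x. real (Suc k) / N < u x} x / N \<le> c k x"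
        using N c_nonneg[of k x] by (auto simp: c_def indicator_def min_def field_simps)
    qed (rule integrable_riesz_measure[OF cc])
    then show ?thesis using open_level by simp
  qed
  have "\<Lambda> u = (\<Sum>k<Suc n. \<Lambda> (c k))"
    using sum[of "{..<Suc n}" c] cc by (simp add: u_eq[abs_def] del: sum.lessThan_Suc)
  also have "\<dots> \<le> (\<Sum>k<Suc n. M.prob {x. real k / N < u x} / N)"
    by (intro sum_mono upper)
  \<comment> \<open>The upper bound for layer \<open>k + 1\<close> and the lower bound for layer
    \<open>k\<close> involve the same superlevel set. After shifting the index only the term
    \<open>k = 0\<close> is unmatched, and it is at most \<open>1 / N\<close>.\<close>
  also have "\<dots> = M.prob {x. 0 < u x} / N + (\<Sum>k<n. M.prob {x. real (Suc k) / N < u x} / N)"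
    by (subst sum.lessThan_Suc_shift) simp
  also have "\<dots> \<le> 1 / N + (\<Sum>k<n. \<integral>x. c k x \<partial>riesz_measure)"
    using N by (intro add_mono sum_mono lower divide_right_mono) auto
  also have "(\<Sum>k<n. \<integral>x. c k x \<partial>riesz_measure) \<le> (\<Sum>k<Suc n. \<integral>x. c k x \<partial>riesz_measure)"
    using c_nonneg by (simp add: integral_nonneg)
  also have "\<dots> = (\<integral>x. u x \<partial>riesz_measure)"
    unfolding u_eq using integrable_riesz_measure[OF cc] by (subst Bochner_Integration.integral_sum) auto
  finally show ?thesis by (simp add: N_def)
qed

text \<open>Thinner and thinner layers give one inequality; applied to \<open>1 - u\<close> it gives
  the reverse one, since the measure and \<open>\<Lambda>\<close> both assign 1 to the constant
  1.\<close>

lemma integral_riesz_measure_unit: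
  assumes u: "continuous_on UNIV u" "\<And>x. 0 \<le> u x" "\<And>x. u x \<le> 1"
  shows "(\<integral>x. u x \<partial>riesz_measure) = \<Lambda> u"
proof -
  interpret M: prob_space riesz_measure by (rule prob_space_riesz_measure)
  have *: "\<Lambda> v \<le> (\<integral>x. v x \<partial>riesz_measure)"
    if v: "continuous_on UNIV v" "\<And>x. 0 \<le> v x" "\<And>x. v x \<le> 1" for v
  proof (rule field_le_epsilon)
    fix e :: real assume "0 < e"
    then obtain n where "1 / real (Suc n) < e" using nat_approx_posE by blast
    then show "\<Lambda> v \<le> (\<integral>x. v x \<partial>riesz_measure) + e"
      using le_integral_riesz_measure_layers[OF v, of n] by simp
  qed
  have "\<Lambda> (\<lambda>x. 1 - u x) \<le> (\<integral>x. 1 - u x \<partial>riesz_measure)"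
    using u by (intro *) (auto intro!: continuous_intros)
  also have "\<dots> = 1 - (\<integral>x. u x \<partial>riesz_measure)"
    using integrable_riesz_measure[OF u(1)] M.prob_space by simp
  also have "\<Lambda> (\<lambda>x. 1 - u x) = 1 - \<Lambda> u" using diff[of "\<lambda>x. 1" u] u(1) one by simp
  finally show ?thesis using *[OF u] by simp
qed

theorem integral_riesz_measure:
  assumes u: "continuous_on UNIV u"
  shows "(\<integral>x. u x \<partial>riesz_measure) = \<Lambda> u"
proof -
  interpret M: prob_space riesz_measure by (rule prob_space_riesz_measure)
  obtain C where C: "0 < C" "\<And>x. norm (u x) \<le> C" using compact_UNIV_bounded[OF compact_UNIV u] by blast
  \<comment> \<open>The values of \<open>u\<close> lie between \<open>- C\<close> and
    \<open>C\<close>; this affine rescaling moves them into the unit interval.\<close>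
  define v where "v = (\<lambda>x. 1 / (2 * C) * (u x + C))"
  have v: "continuous_on UNIV v" unfolding v_def by (intro continuous_intros u)
  have "0 \<le> v x" "v x \<le> 1" for x
  proof -
    have "- C \<le> u x" "u x \<le> C" using C(2)[of x] by auto
    then show "0 \<le> v x" "v x \<le> 1" using C(1) by (simp_all add: v_def)
  qed
  then have "(\<integral>x. v x \<partial>riesz_measure) = \<Lambda> v" by (rule integral_riesz_measure_unit[OF v])
  moreover have "\<Lambda> v = (1 / (2 * C)) * (\<Lambda> u + C)"
  proof -
    have "\<Lambda> (\<lambda>x. u x + C) = \<Lambda> u + C"
      using add[OF u continuous_on_const, of C] by (simp only: const)
    moreover have "continuous_on UNIV (\<lambda>x. u x + C)" by (intro continuous_intros u)
    ultimately show ?thesis by (simp only: v_def scale)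
  qed
  moreover have "(\<integral>x. v x \<partial>riesz_measure) = (1 / (2 * C)) * ((\<integral>x. u x \<partial>riesz_measure) + C)"
  proof -
    have "(\<integral>x. u x + C \<partial>riesz_measure) = (\<integral>x. u x \<partial>riesz_measure) + C"
      using integrable_riesz_measure[OF u] M.prob_space by simp
    then show ?thesis by (simp only: v_def integral_mult_right_zero)
  qed
  ultimately have "(1 / (2 * C)) * ((\<integral>x. u x \<partial>riesz_measure) + C) = (1 / (2 * C)) * (\<Lambda> u + C)"
    by simp
  moreover have "1 / (2 * C) \<noteq> 0" using C(1) by simp
  ultimately show ?thesis by (metis mult_left_cancel add_right_cancel)
qed

lemma riesz_measure_outer_regular:
  assumes "E \<in> sets borel" "0 < e"
  obtains U where "open U" "E \<subseteq> U" "measure riesz_measure U < measure riesz_measure E + e"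
proof -
  obtain U where "open U" "E \<subseteq> U" "open_mass U < outer_mass E + e"
    by (rule outer_mass_approx[OF assms(2)])
  then show ?thesis
    using that[of U] assms(1) by (simp add: measure_riesz_measure outer_mass_open)
qed

theorem riesz_measure_regular:
  assumes E: "E \<in> sets borel" and e: "0 < e"
  obtains K U where "compact K" "open U" "K \<subseteq> E" "E \<subseteq> U" "measure riesz_measure (U - K) < e"
proof -
  interpret M: prob_space riesz_measure by (rule prob_space_riesz_measure)
  obtain U where U: "open U" "E \<subseteq> U" "M.prob U < M.prob E + e / 2"
    by (rule riesz_measure_outer_regular[OF E half_gt_zero[OF e]])
  \<comment> \<open>Inner approximation is outer approximation of the complement: \<open>- V\<close>
    is closed in a compact space, hence compact. Each side costs \<open>e / 2\<close>.\<close>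
  have "- E \<in> sets borel" using E by auto
  then obtain V where V: "open V" "- E \<subseteq> V" "M.prob V < M.prob (- E) + e / 2"
    by (rule riesz_measure_outer_regular[OF _ half_gt_zero[OF e]])
  have sets: "U - E \<in> M.events" "V - - E \<in> M.events" "U \<in> M.events" "V \<in> M.events"
    "- E \<in> M.events" "E \<in> M.events"
    using U(1) V(1) E by auto
  have "U - - V \<subseteq> (U - E) \<union> (V - - E)" by auto
  then have "M.prob (U - - V) \<le> M.prob ((U - E) \<union> (V - - E))"
    by (intro M.finite_measure_mono sets.Un sets)
  also have "\<dots> \<le> M.prob (U - E) + M.prob (V - - E)"
    by (intro measure_Un_le sets)
  also have "\<dots> < e"
    using U(2,3) V(2,3) M.finite_measure_Diff[OF sets(3,6) U(2)] M.finite_measure_Diff[OF sets(4,5) V(2)]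
    by linarith
  finally have "M.prob (U - - V) < e" .
  moreover have "compact (- V)"
    using closed_Int_compact[OF _ compact_UNIV, of "- V"] V(1) by auto
  ultimately show ?thesis using U(1,2) V(2) by (intro that[of "- V" U]) auto
qed

end

section \<open>Linear functionals dominated by sublinear ones\<close>

text \<open>Homogeneity is only an inequality for \<open>c > 0\<close>: this form is easy to check
  for infima and improves itself to an equality by rescaling with \<open>1 / c\<close>.\<close>

definition sublinear :: "('a::real_vector \<Rightarrow> real) \<Rightarrow> bool" where
  "sublinear p \<longleftrightarrow> (\<forall>x y. p (x + y) \<le> p x + p y) \<and> (\<forall>c>0. \<forall>x. p (c *\<^sub>R x) \<le> c * p x)"

lemma sublinear_zero_nonneg: "sublinear p \<Longrightarrow> 0 \<le> p 0"
  unfolding sublinear_def by (metis add_0 le_add_same_cancel1)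

text \<open>The lower bound depends on \<open>r\<close> alone, so pointwise infima of sublinear
  functionals below a common \<open>r\<close> are finite.\<close>

lemma sublinear_lower:
  assumes "sublinear p" "\<And>x. p x \<le> r x"
  shows "- r (- x) \<le> p x"
proof -
  have "0 \<le> p (x + - x)" using sublinear_zero_nonneg[OF assms(1)] by simp
  also have "\<dots> \<le> p x + p (- x)" using assms(1) unfolding sublinear_def by blast
  finally show ?thesis using assms(2)[of "- x"] by simp
qed

lemma sublinear_scale:
  assumes "sublinear p" "c > 0"
  shows "p (c *\<^sub>R x) = c * p x"
proof (rule antisym)
  show "p (c *\<^sub>R x) \<le> c * p x" using assms by (auto simp: sublinear_def)
  have "p ((1 / c) *\<^sub>R (c *\<^sub>R x)) \<le> (1 / c) * p (c *\<^sub>R x)"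
    using assms unfolding sublinear_def by (metis zero_less_divide_1_iff)
  then show "c * p x \<le> p (c *\<^sub>R x)"
    using assms(2) by (simp add: field_simps)
qed

text \<open>A pointwise minimal sublinear functional is linear: otherwise
  \<open>x \<mapsto> inf\<^sub>t (p (x + t v) - t p v)\<close> would be a smaller one.\<close>

lemma minimal_sublinear_linear:
  assumes p: "sublinear p"
    and minimal: "\<And>q. sublinear q \<Longrightarrow> (\<And>x. q x \<le> p x) \<Longrightarrow> q = p"
  shows "linear p"
proof -
  note sub = p[unfolded sublinear_def, THEN conjunct1, rule_format]
  have add: "p (x + v) = p x + p v" for x v
  proof -
    define S where "S x = (\<lambda>t. p (x + t *\<^sub>R v) - t * p v) ` {0..}" for x
    define q where "q x = Inf (S x)" for x
    have ne: "S x \<noteq> {}" for x by (auto simp: S_def)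
    have bdd: "bdd_below (S x)" for x
      unfolding S_def
    proof (rule bdd_belowI2)
      fix t :: real assume "t \<in> {0..}"
      have "p (t *\<^sub>R v) = t * p v \<or> t = 0"
        using \<open>t \<in> {0..}\<close> sublinear_scale[OF p, of t v] by force
      moreover have "p (t *\<^sub>R v) \<le> p (x + t *\<^sub>R v) + p (- x)"
        using sub[of "x + t *\<^sub>R v" "- x"] by simp
      moreover have "0 \<le> p x + p (- x)"
        using sublinear_zero_nonneg[OF p] sub[of x "- x"] by simp
      ultimately show "- p (- x) \<le> p (x + t *\<^sub>R v) - t * p v" by auto
    qed
    have q_le: "q x \<le> p (x + t *\<^sub>R v) - t * p v" if "t \<ge> 0" for x t
      unfolding q_def using that by (intro cInf_lower bdd) (auto simp: S_def)
    have q_ge: "c \<le> q x" if "\<And>t. t \<ge> 0 \<Longrightarrow> c \<le> p (x + t *\<^sub>R v) - t * p v" for c x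
      unfolding q_def using ne that by (intro cInf_greatest) (auto simp: S_def)
    have "sublinear q"
      unfolding sublinear_def
    proof (intro conjI allI impI)
      fix x y
      have "q (x + y) - q y \<le> q x"
      proof (rule q_ge)
        fix s :: real assume s: "0 \<le> s"
        have "q (x + y) - (p (x + s *\<^sub>R v) - s * p v) \<le> q y"
        proof (rule q_ge)
          fix t :: real assume t: "0 \<le> t"
          have "q (x + y) \<le> p ((x + y) + (s + t) *\<^sub>R v) - (s + t) * p v"
            using s t by (intro q_le) auto
          also have "(x + y) + (s + t) *\<^sub>R v = (x + s *\<^sub>R v) + (y + t *\<^sub>R v)"
            by (simp add: algebra_simps)
          also have "p \<dots> \<le> p (x + s *\<^sub>R v) + p (y + t *\<^sub>R v)" by (rule sub)
          finally show "q (x + y) - (p (x + s *\<^sub>R v) - s * p v) \<le> p (y + t *\<^sub>R v) - t * p v"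
            by (simp add: algebra_simps)
        qed
        then show "q (x + y) - q y \<le> p (x + s *\<^sub>R v) - s * p v" by simp
      qed
      then show "q (x + y) \<le> q x + q y" by simp
    next
      fix c :: real and x assume c: "0 < c"
      have "q (c *\<^sub>R x) / c \<le> q x"
      proof (rule q_ge)
        fix t :: real assume t: "0 \<le> t"
        have "q (c *\<^sub>R x) \<le> p (c *\<^sub>R x + (c * t) *\<^sub>R v) - (c * t) * p v"
          using c t by (intro q_le) auto
        also have "c *\<^sub>R x + (c * t) *\<^sub>R v = c *\<^sub>R (x + t *\<^sub>R v)"
          by (simp add: algebra_simps)
        also have "p \<dots> = c * p (x + t *\<^sub>R v)" using c by (rule sublinear_scale[OF p])
        finally have "q (c *\<^sub>R x) \<le> c * (p (x + t *\<^sub>R v) - t * p v)"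
          by (simp add: algebra_simps)
        then show "q (c *\<^sub>R x) / c \<le> p (x + t *\<^sub>R v) - t * p v"
          using c by (simp add: pos_divide_le_eq mult.commute)
      qed
      then show "q (c *\<^sub>R x) \<le> c * q x" using c by (simp add: pos_divide_le_eq mult.commute)
    qed
    moreover have "q x \<le> p x" for x using q_le[of 0 x] by simp
    \<comment> \<open>Minimality returns \<open>p\<close> itself; the competitor
      \<open>t = 1\<close> in the infimum then gives the inequality opposite to
      subadditivity.\<close>
    ultimately have "q = p" by (rule minimal)
    then have "p x \<le> p (x + v) - p v" using q_le[of 1 x] by simp
    then show ?thesis using sub[of x v] by simp
  qed
  have zero: "p 0 = 0" using add[of 0 0] by simp
  have neg: "p (- x) = - p x" for x using add[of x "- x"] zero by simp
  have "p (c *\<^sub>R x) = c * p x" for c x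
  proof (cases c "0 :: real" rule: linorder_cases)
    case less
    then have "p ((- c) *\<^sub>R x) = (- c) * p x" by (intro sublinear_scale[OF p]) auto
    then show ?thesis using neg[of "c *\<^sub>R x"] by simp
  qed (auto simp: zero sublinear_scale[OF p])
  then show ?thesis using add by (intro linearI) auto
qed

text \<open>Hahn-Banach by minimality: Zorn's lemma, applied downwards to the sublinear functionals
  below \<open>p\<close>, gives a minimal one, which is linear. A chain is bounded by its pointwise
  infimum.\<close>

theorem sublinear_dominates_linear:
  fixes p :: "'a::real_vector \<Rightarrow> real"
  assumes p: "sublinear p"
  shows "\<exists>L. linear L \<and> (\<forall>x. L x \<le> p x)"
proof -
  define A where "A = {q. sublinear q \<and> (\<forall>x. q x \<le> p x)}"
  define P where "P q r \<longleftrightarrow> (\<forall>x. r x \<le> q x)" for q r :: "'a \<Rightarrow> real"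
  have "\<exists>m\<in>A. \<forall>a\<in>A. P m a \<longrightarrow> a = m"
  proof (rule predicate_Zorn)
    show "partial_order_on A (relation_of P A)"
      by (rule partial_order_on_relation_ofI) (auto simp: P_def fun_eq_iff intro: order_trans antisym)
  next
    fix C assume C: "C \<in> Chains (relation_of P A)"
    then have CA: "C \<subseteq> A" by (auto simp: Chains_def relation_of_def)
    have tot: "P q r \<or> P r q" if "q \<in> C" "r \<in> C" for q r
      using C that by (auto simp: Chains_def relation_of_def)
    show "\<exists>u\<in>A. \<forall>a\<in>C. P a u"
    proof (cases "C = {}")
      case True
      then show ?thesis using p by (auto simp: A_def)
    next
      case False
      define u where "u x = (INF q\<in>C. q x)" for x
      have u_le: "u x \<le> q x" if "q \<in> C" for q x
        unfolding u_def
      proof (rule cINF_lower[OF bdd_belowI2 that])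
        fix r assume "r \<in> C"
        then show "- p (- x) \<le> r x" using CA by (intro sublinear_lower) (auto simp: A_def)
      qed
      have u_ge: "c \<le> u x" if "\<And>q. q \<in> C \<Longrightarrow> c \<le> q x" for c x
        unfolding u_def using False that by (intro cINF_greatest) auto
      have "sublinear u"
        unfolding sublinear_def
      proof (intro conjI allI impI)
        fix x y
        have "u (x + y) - u y \<le> u x"
        proof (rule u_ge)
          fix q assume q: "q \<in> C"
          have "u (x + y) - q x \<le> u y"
          proof (rule u_ge)
            fix r assume r: "r \<in> C"
            \<comment> \<open>Subadditivity of the infimum calls for one member below both
              \<open>q\<close> and \<open>r\<close>; in a chain the smaller of the two
              serves.\<close>
            obtain s where s: "s \<in> C" "P q s" "P r s"
              using tot[OF q r] q r by (auto simp: P_def)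
            have "u (x + y) \<le> s (x + y)" using s by (intro u_le)
            also have "\<dots> \<le> s x + s y" using s(1) CA by (auto simp: A_def sublinear_def)
            also have "\<dots> \<le> q x + r y" using s(2,3) by (intro add_mono) (auto simp: P_def)
            finally show "u (x + y) - q x \<le> r y" by simp
          qed
          then show "u (x + y) - u y \<le> q x" by simp
        qed
        then show "u (x + y) \<le> u x + u y" by simp
      next
        fix c :: real and x assume c: "0 < c"
        have "u (c *\<^sub>R x) / c \<le> u x"
        proof (rule u_ge)
          fix q assume q: "q \<in> C"
          have "u (c *\<^sub>R x) \<le> q (c *\<^sub>R x)" using q by (rule u_le)
          also have "\<dots> \<le> c * q x" using q c CA by (auto simp: A_def sublinear_def)
          finally show "u (c *\<^sub>R x) / c \<le> q x"
            using c by (simp add: pos_divide_le_eq mult.commute)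
        qed
        then show "u (c *\<^sub>R x) \<le> c * u x" using c by (simp add: pos_divide_le_eq mult.commute)
      qed
      moreover have "u x \<le> p x" for x
      proof -
        obtain q where "q \<in> C" using False by blast
        then have "u x \<le> q x" "q x \<le> p x" using u_le CA by (auto simp: A_def)
        then show ?thesis by simp
      qed
      ultimately show ?thesis using u_le by (auto simp: A_def P_def)
    qed
  qed
  then obtain m where m: "sublinear m" "\<And>x. m x \<le> p x"
    "\<And>q. sublinear q \<Longrightarrow> (\<And>x. q x \<le> p x) \<Longrightarrow> (\<And>x. q x \<le> m x) \<Longrightarrow> q = m"
    by (auto simp: A_def P_def)
  have "linear m"
    using m(2) by (intro minimal_sublinear_linear m(1) m(3)) (auto intro: order_trans)
  then show ?thesis using m(2) by blast
qed

section \<open>States extending multiplicative functionals\<close>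

locale compact_invariant =
  fixes A :: "('g::{topological_group_add, t2_space} \<Rightarrow> complex) set"
  assumes compact_UNIV: "compact (UNIV :: 'g set)"
    and invariant: "invariant_algebra A"
begin

abbreviation "M_A \<equiv> mult_functionals A"

lemma A_cont: "f \<in> A \<Longrightarrow> continuous_on UNIV f"
  and A_const: "(\<lambda>x. c) \<in> A"
  and A_add: "f \<in> A \<Longrightarrow> g \<in> A \<Longrightarrow> (\<lambda>x. f x + g x) \<in> A"
  and A_mult: "f \<in> A \<Longrightarrow> g \<in> A \<Longrightarrow> (\<lambda>x. f x * g x) \<in> A"
  and A_scale: "f \<in> A \<Longrightarrow> (\<lambda>x. c * f x) \<in> A"
  and A_ltrans: "f \<in> A \<Longrightarrow> (\<lambda>x. f (a + x)) \<in> A"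
  and A_rtrans: "f \<in> A \<Longrightarrow> (\<lambda>x. f (x + a)) \<in> A"
  and A_closed: "closed {F :: 'g \<Rightarrow>\<^sub>C complex. apply_bcontfun F \<in> A}"
  using invariant unfolding invariant_algebra_def by blast+

lemma A_diff: "f \<in> A \<Longrightarrow> g \<in> A \<Longrightarrow> (\<lambda>x. f x - g x) \<in> A"
  using A_add[OF _ A_scale[of g "-1"], of f] by simp

lemma A_sum: "finite I \<Longrightarrow> (\<And>i. i \<in> I \<Longrightarrow> f i \<in> A) \<Longrightarrow> (\<lambda>x. \<Sum>i\<in>I. f i x) \<in> A"
  by (induction I rule: finite_induct) (auto intro: A_const A_add)

lemma A_power: "f \<in> A \<Longrightarrow> (\<lambda>x. f x ^ n) \<in> A"
  by (induction n) (auto intro: A_const A_mult)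

lemma cont_bcontfun:
  fixes u :: "'g \<Rightarrow> 'b::real_normed_vector"
  assumes "continuous_on UNIV u"
  shows "u \<in> bcontfun"
  using compact_UNIV_bounded[OF compact_UNIV assms] bcontfun_normI[OF assms] by blast

lemma A_uniform_limit:
  assumes "\<And>e. 0 < e \<Longrightarrow> \<exists>f\<in>A. \<forall>x. norm (F x - f x) \<le> e"
  shows "F \<in> A"
proof -
  have "\<exists>f\<in>A. \<forall>x. norm (F x - f x) \<le> inverse (real (Suc n))" for n
    by (rule assms) auto
  then obtain f where f: "\<And>n. f n \<in> A" "\<And>n x. norm (F x - f n x) \<le> inverse (real (Suc n))"
    by metis
  have lim: "uniform_limit UNIV f F sequentially"
  proof (rule uniform_limitI)
    fix e :: real assume "0 < e"
    then have "\<forall>\<^sub>F n in sequentially. inverse (real (Suc n)) < e"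
      using LIMSEQ_inverse_real_of_nat by (auto dest: order_tendstoD(2))
    then show "\<forall>\<^sub>F n in sequentially. \<forall>x\<in>UNIV. dist (f n x) (F x) < e"
      by eventually_elim (auto simp: dist_norm norm_minus_commute intro: le_less_trans[OF f(2)])
  qed
  have cF: "continuous_on UNIV F"
    by (rule uniform_limit_theorem[OF _ lim]) (auto intro!: always_eventually A_cont f)
  have ap: "apply_bcontfun (Bcontfun F) = F" "apply_bcontfun (Bcontfun (f n)) = f n" for n
    using cF f(1) by (auto intro!: Bcontfun_inverse cont_bcontfun A_cont)
  have "(\<lambda>n. Bcontfun (f n)) \<longlonglongrightarrow> Bcontfun F"
    by (rule uniform_limit_tendsto_bcontfun) (simp add: ap lim)
  then have "Bcontfun F \<in> {F. apply_bcontfun F \<in> A}"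
    by (rule closed_sequentially[OF A_closed, rotated]) (simp add: ap f)
  then show ?thesis by (simp add: ap)
qed

section \<open>Norm bound and positivity of multiplicative functionals\<close>

lemma M_A_add: "\<phi> \<in> M_A \<Longrightarrow> f \<in> A \<Longrightarrow> g \<in> A \<Longrightarrow> \<phi> (\<lambda>x. f x + g x) = \<phi> f + \<phi> g"
  and M_A_scale: "\<phi> \<in> M_A \<Longrightarrow> f \<in> A \<Longrightarrow> \<phi> (\<lambda>x. c * f x) = c * \<phi> f"
  and M_A_mult: "\<phi> \<in> M_A \<Longrightarrow> f \<in> A \<Longrightarrow> g \<in> A \<Longrightarrow> \<phi> (\<lambda>x. f x * g x) = \<phi> f * \<phi> g"
  and M_A_extensional: "\<phi> \<in> M_A \<Longrightarrow> \<phi> \<in> extensional A"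
  by (auto simp: mult_functionals_def)

lemma M_A_eqI: "\<phi> \<in> M_A \<Longrightarrow> \<psi> \<in> M_A \<Longrightarrow> (\<And>f. f \<in> A \<Longrightarrow> \<phi> f = \<psi> f) \<Longrightarrow> \<phi> = \<psi>"
  by (rule extensionalityI[OF M_A_extensional M_A_extensional])

lemma M_A_one:
  assumes "\<phi> \<in> M_A"
  shows "\<phi> (\<lambda>x. 1) = 1"
proof -
  obtain f where "f \<in> A" "\<phi> f \<noteq> 0" using assms by (auto simp: mult_functionals_def)
  then show ?thesis using M_A_mult[OF assms A_const, of f 1] by simp
qed

lemma M_A_const: "\<phi> \<in> M_A \<Longrightarrow> \<phi> (\<lambda>x. c) = c"
  using M_A_scale[of \<phi> "\<lambda>x. 1" c] A_const M_A_one by simp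

lemma M_A_diff: "\<phi> \<in> M_A \<Longrightarrow> f \<in> A \<Longrightarrow> g \<in> A \<Longrightarrow> \<phi> (\<lambda>x. f x - g x) = \<phi> f - \<phi> g"
  using M_A_add[of \<phi> f "\<lambda>x. (-1) * g x"] M_A_scale[of \<phi> g "-1"] A_scale[of g "-1"] by simp

lemma M_A_sum:
  assumes "\<phi> \<in> M_A" "finite I" "\<And>i. i \<in> I \<Longrightarrow> f i \<in> A"
  shows "\<phi> (\<lambda>x. \<Sum>i\<in>I. f i x) = (\<Sum>i\<in>I. \<phi> (f i))"
  using assms(2,3)
proof (induction I rule: finite_induct)
  case empty
  then show ?case using M_A_const[OF assms(1)] by simp
next
  case (insert i I)
  then show ?case using M_A_add[OF assms(1), of "f i" "\<lambda>x. \<Sum>i\<in>I. f i x"] by (simp add: A_sum)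
qed

text \<open>Automatic continuity: if \<open>\<phi> f\<close> exceeded \<open>C\<close> in modulus,
  \<open>g = f / \<phi> f\<close> would have norm below 1. The geometric series then inverts
  \<open>1 - g\<close> inside the closed algebra \<open>A\<close>, although \<open>\<phi>\<close>
  annihilates \<open>1 - g\<close>.\<close>

lemma M_A_bound:
  assumes \<phi>: "\<phi> \<in> M_A" and f: "f \<in> A" and C: "\<And>x. norm (f x) \<le> C"
  shows "norm (\<phi> f) \<le> C"
proof (rule ccontr)
  assume "\<not> norm (\<phi> f) \<le> C"
  then have less: "C < norm (\<phi> f)" by simp
  have "0 \<le> C" using C[of 0] norm_ge_zero order_trans by blast
  then have nz: "\<phi> f \<noteq> 0" using less by auto
  define g where "g x = (1 / \<phi> f) * f x" for x
  define r where "r = C / norm (\<phi> f)"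
  have r: "0 \<le> r" "r < 1" using less \<open>0 \<le> C\<close> nz by (auto simp: r_def divide_less_eq)
  have gA: "g \<in> A" unfolding g_def by (rule A_scale[OF f])
  have \<phi>g: "\<phi> g = 1" unfolding g_def using M_A_scale[OF \<phi> f, of "1 / \<phi> f"] nz by simp
  have g_le: "norm (g x) \<le> r" for x
    using C[of x] nz by (simp add: g_def r_def norm_divide divide_right_mono)
  have g_ne: "1 - g x \<noteq> 0" for x
    using g_le[of x] r by auto
  have g_ge: "1 - r \<le> norm (1 - g x)" for x
    using g_le[of x] norm_triangle_ineq2[of 1 "g x"] by simp
  define h where "h x = 1 / (1 - g x)" for x
  have "h \<in> A"
  proof (rule A_uniform_limit)
    fix e :: real assume e: "0 < e"
    have "(\<lambda>n. r ^ n / (1 - r)) \<longlonglongrightarrow> 0 / (1 - r)"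
      using r by (intro tendsto_intros LIMSEQ_realpow_zero) auto
    then obtain n where n: "r ^ n / (1 - r) < e"
      using e order_tendstoD(2)[of "\<lambda>n. r ^ n / (1 - r)" 0 sequentially e]
      by (auto simp: eventually_sequentially)
    have "norm (h x - (\<Sum>k<n. g x ^ k)) \<le> e" for x
    proof -
      have "h x - (\<Sum>k<n. g x ^ k) = g x ^ n / (1 - g x)"
        using g_ne[of x] sum_gp_strict[of "g x" n] by (auto simp: h_def field_simps)
      also have "norm \<dots> \<le> r ^ n / (1 - r)"
        unfolding norm_divide norm_power using g_le g_ge r by (intro frac_le power_mono) auto
      finally show ?thesis using n by simp
    qed
    then show "\<exists>f\<in>A. \<forall>x. norm (h x - f x) \<le> e"
      by (intro bexI[of _ "\<lambda>x. \<Sum>k<n. g x ^ k"] A_sum A_power gA) auto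
  qed
  \<comment> \<open>With \<open>\<phi> g = 1\<close> this identity turns into
    \<open>\<phi> h = 1 + \<phi> h\<close>.\<close>
  moreover have "h = (\<lambda>x. 1 + g x * h x)"
    using g_ne by (auto simp: h_def fun_eq_iff field_simps)
  ultimately have "\<phi> h = 1 + \<phi> g * \<phi> h"
    using M_A_add[OF \<phi> A_const A_mult[OF gA], of h 1] M_A_mult[OF \<phi> gA] M_A_one[OF \<phi>] by metis
  then show False using \<phi>g by simp
qed

text \<open>A function with nonnegative real part and modulus at most \<open>C\<close> stays within
  \<open>sqrt (R\<^sup>2 + C\<^sup>2)\<close> of each constant \<open>R \<ge> 0\<close>. By the norm
  bound so does \<open>\<phi> f\<close>, which is impossible for large \<open>R\<close> if its real
  part is \<open>- d < 0\<close>.\<close>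

lemma M_A_positive:
  assumes \<phi>: "\<phi> \<in> M_A" and f: "f \<in> A" and pos: "\<And>x. 0 \<le> Re (f x)"
  shows "0 \<le> Re (\<phi> f)"
proof (rule ccontr)
  assume "\<not> 0 \<le> Re (\<phi> f)"
  define d where "d = - Re (\<phi> f)"
  have d: "0 < d" using \<open>\<not> 0 \<le> Re (\<phi> f)\<close> by (simp add: d_def)
  obtain C where C: "0 < C" "\<And>x. norm (f x) \<le> C" using compact_UNIV_bounded[OF compact_UNIV A_cont[OF f]] by blast
  \<comment> \<open>With this choice the cross term \<open>2 * R * d\<close> of
    \<open>(R + d)\<^sup>2\<close> equals \<open>2 * C\<^sup>2\<close>, more than the available
    \<open>C\<^sup>2\<close>.\<close>
  define R where "R = C\<^sup>2 / d"
  have R: "0 \<le> R" using d by (simp add: R_def)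
  have "norm (complex_of_real R - f x) \<le> sqrt (R\<^sup>2 + C\<^sup>2)" for x
  proof (rule real_le_rsqrt)
    have "(norm (complex_of_real R - f x))\<^sup>2 = R\<^sup>2 - 2 * R * Re (f x) + (norm (f x))\<^sup>2"
      by (simp only: cmod_power2) (simp add: power2_eq_square algebra_simps)
    also have "\<dots> \<le> R\<^sup>2 + C\<^sup>2"
      using R pos[of x] power_mono[OF C(2)[of x] norm_ge_zero, of 2] mult_nonneg_nonneg[of R "Re (f x)"]
      by linarith
    finally show "(norm (complex_of_real R - f x))\<^sup>2 \<le> R\<^sup>2 + C\<^sup>2" .
  qed
  then have "norm (\<phi> (\<lambda>x. complex_of_real R - f x)) \<le> sqrt (R\<^sup>2 + C\<^sup>2)"
    by (intro M_A_bound[OF \<phi>] A_diff A_const f)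
  then have "norm (complex_of_real R - \<phi> f) \<le> sqrt (R\<^sup>2 + C\<^sup>2)"
    using M_A_diff[OF \<phi> A_const f] M_A_const[OF \<phi>] by simp
  moreover have "R + d \<le> norm (complex_of_real R - \<phi> f)"
    using complex_Re_le_cmod[of "complex_of_real R - \<phi> f"] by (simp add: d_def)
  ultimately have "R + d \<le> sqrt (R\<^sup>2 + C\<^sup>2)" by simp
  then have "(R + d)\<^sup>2 \<le> R\<^sup>2 + C\<^sup>2"
    using R d by (metis add_nonneg_nonneg less_imp_le power_mono real_sqrt_pow2 sum_power2_ge_zero)
  moreover have "R * d = C\<^sup>2" using d by (simp add: R_def)
  ultimately have "C\<^sup>2 + d\<^sup>2 \<le> 0" by (simp add: power2_eq_square algebra_simps)
  then show False using C(1) d by (metis add_pos_pos not_le zero_less_power)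
qed

text \<open>\<open>p u\<close> is the infimum of \<open>Re (\<phi> f)\<close> over the
  \<open>f \<in> A\<close> whose real part dominates \<open>u\<close>; positivity keeps it finite. A
  linear functional below \<open>p\<close> is positive, and it agrees with \<open>\<phi>\<close> on
  real parts because \<open>f\<close> and \<open>- f\<close> both compete.\<close>

lemma ex_state:
  assumes \<phi>: "\<phi> \<in> M_A"
  shows "\<exists>\<Lambda>. state \<Lambda> \<and> (\<forall>f\<in>A. \<phi> f = Complex (\<Lambda> (\<lambda>x. Re (f x))) (\<Lambda> (\<lambda>x. Im (f x))))"
proof -
  define S where "S u = {Re (\<phi> f) |f. f \<in> A \<and> (\<forall>x. apply_bcontfun u x \<le> Re (f x))}"
    for u :: "'g \<Rightarrow>\<^sub>C real"
  define p where "p u = Inf (S u)" for u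
  have bcont: "\<exists>C>0. \<forall>x. norm (apply_bcontfun u x) \<le> C" for u :: "'g \<Rightarrow>\<^sub>C real"
    by (rule compact_UNIV_bounded[OF compact_UNIV]) simp
  have ne: "S u \<noteq> {}" for u
  proof -
    obtain C where "\<forall>x. norm (apply_bcontfun u x) \<le> C" using bcont by blast
    then have "\<forall>x. apply_bcontfun u x \<le> Re (complex_of_real C)"
      by (metis Re_complex_of_real abs_le_D1 real_norm_def)
    then show ?thesis using A_const[of "complex_of_real C"] by (auto simp: S_def)
  qed
  have bdd: "bdd_below (S u)" for u
  proof -
    obtain C where C: "\<forall>x. norm (apply_bcontfun u x) \<le> C" using bcont by blast
    have "- C \<le> Re (\<phi> f)" if "f \<in> A" "\<forall>x. apply_bcontfun u x \<le> Re (f x)" for f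
    proof -
      have "0 \<le> Re (\<phi> (\<lambda>x. f x + complex_of_real C))"
      proof (intro M_A_positive[OF \<phi>] A_add A_const that)
        fix x
        have "- C \<le> apply_bcontfun u x" using C[rule_format, of x] by auto
        then show "0 \<le> Re (f x + complex_of_real C)" using that(2)[rule_format, of x] by simp
      qed
      then show ?thesis using M_A_add[OF \<phi> that(1) A_const] M_A_const[OF \<phi>] by simp
    qed
    then show ?thesis by (auto simp: S_def intro!: bdd_belowI[of _ "- C"])
  qed
  have p_le: "p u \<le> Re (\<phi> f)" if "f \<in> A" "\<And>x. apply_bcontfun u x \<le> Re (f x)" for u f
    unfolding p_def using that by (intro cInf_lower bdd) (auto simp: S_def)
  have p_ge: "c \<le> p u" if "\<And>f. f \<in> A \<Longrightarrow> (\<And>x. apply_bcontfun u x \<le> Re (f x)) \<Longrightarrow> c \<le> Re (\<phi> f)" for u c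
    unfolding p_def using ne that by (intro cInf_greatest) (auto simp: S_def)
  have "sublinear p"
    unfolding sublinear_def
  proof (intro conjI allI impI)
    fix u v
    have "p (u + v) - p v \<le> p u"
    proof (rule p_ge)
      fix f assume f: "f \<in> A" "\<And>x. apply_bcontfun u x \<le> Re (f x)"
      have "p (u + v) - Re (\<phi> f) \<le> p v"
      proof (rule p_ge)
        fix g assume g: "g \<in> A" "\<And>x. apply_bcontfun v x \<le> Re (g x)"
        have "p (u + v) \<le> Re (\<phi> (\<lambda>x. f x + g x))"
          using f g by (intro p_le A_add) (auto intro: add_mono)
        then show "p (u + v) - Re (\<phi> f) \<le> Re (\<phi> g)" using M_A_add[OF \<phi> f(1) g(1)] by simp
      qed
      then show "p (u + v) - p v \<le> Re (\<phi> f)" by simp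
    qed
    then show "p (u + v) \<le> p u + p v" by simp
  next
    fix c :: real and u assume c: "0 < c"
    have "p (c *\<^sub>R u) / c \<le> p u"
    proof (rule p_ge)
      fix f assume f: "f \<in> A" "\<And>x. apply_bcontfun u x \<le> Re (f x)"
      have "p (c *\<^sub>R u) \<le> Re (\<phi> (\<lambda>x. complex_of_real c * f x))"
        using f c by (intro p_le A_scale) auto
      then show "p (c *\<^sub>R u) / c \<le> Re (\<phi> f)"
        using M_A_scale[OF \<phi> f(1)] c by (simp add: pos_divide_le_eq mult.commute)
    qed
    then show "p (c *\<^sub>R u) \<le> c * p u" using c by (simp add: pos_divide_le_eq mult.commute)
  qed
  then obtain L where L: "linear L" "\<And>u. L u \<le> p u" using sublinear_dominates_linear by blast
  define \<Lambda> where "\<Lambda> u = L (Bcontfun u)" for u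
  have ap: "apply_bcontfun (Bcontfun u) = u" if "continuous_on UNIV u" for u :: "'g \<Rightarrow> real"
    using that by (intro Bcontfun_inverse cont_bcontfun)
  have \<Lambda>_le: "\<Lambda> u \<le> Re (\<phi> f)"
    if "continuous_on UNIV u" "f \<in> A" "\<And>x. u x \<le> Re (f x)" for u f
    using L(2)[of "Bcontfun u"] p_le[OF that(2), of "Bcontfun u"] that by (simp add: ap \<Lambda>_def)
  have scale: "\<Lambda> (\<lambda>x. c * u x) = c * \<Lambda> u" if u: "continuous_on UNIV u" for u c
  proof -
    have "Bcontfun (\<lambda>x. c * u x) = c *\<^sub>R Bcontfun u"
      by (rule bcontfun_eqI) (simp add: ap u continuous_on_mult_left)
    then show ?thesis by (simp add: \<Lambda>_def linear_scale[OF L(1)])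
  qed
  have \<Lambda>_Re: "\<Lambda> (\<lambda>x. Re (f x)) = Re (\<phi> f)" if f: "f \<in> A" for f
  proof (rule antisym)
    have c: "continuous_on UNIV (\<lambda>x. Re (f x))" by (intro continuous_intros A_cont f)
    show "\<Lambda> (\<lambda>x. Re (f x)) \<le> Re (\<phi> f)" by (rule \<Lambda>_le[OF c f]) simp
    have "\<Lambda> (\<lambda>x. (-1) * Re (f x)) \<le> Re (\<phi> (\<lambda>x. (-1) * f x))"
      by (intro \<Lambda>_le A_scale f continuous_intros A_cont) auto
    then show "Re (\<phi> f) \<le> \<Lambda> (\<lambda>x. Re (f x))"
      using scale[OF c, of "-1"] M_A_scale[OF \<phi> f, of "-1"] by simp
  qed
  have "state \<Lambda>"
  proof
    fix u v :: "'g \<Rightarrow> real" assume c: "continuous_on UNIV u" "continuous_on UNIV v"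
    have "Bcontfun (\<lambda>x. u x + v x) = Bcontfun u + Bcontfun v"
      by (rule bcontfun_eqI) (simp add: ap c continuous_on_add)
    then show "\<Lambda> (\<lambda>x. u x + v x) = \<Lambda> u + \<Lambda> v" by (simp add: \<Lambda>_def linear_add[OF L(1)])
  next
    fix u :: "'g \<Rightarrow> real" assume u: "continuous_on UNIV u" "\<And>x. 0 \<le> u x"
    have "\<Lambda> (\<lambda>x. (-1) * u x) \<le> Re (\<phi> (\<lambda>x. 0))"
      using u by (intro \<Lambda>_le A_const continuous_intros) auto
    then show "0 \<le> \<Lambda> u" using scale[OF u(1), of "-1"] M_A_const[OF \<phi>] by simp
  next
    show "\<Lambda> (\<lambda>x. 1) = 1" using \<Lambda>_Re[OF A_const[of 1]] M_A_one[OF \<phi>] by simp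
  qed (auto intro: compact_UNIV scale)
  moreover have "\<phi> f = Complex (\<Lambda> (\<lambda>x. Re (f x))) (\<Lambda> (\<lambda>x. Im (f x)))" if f: "f \<in> A" for f
  proof -
    \<comment> \<open>The imaginary part of \<open>f\<close> is the real part of
      \<open>- \<i> * f\<close>, which reduces this case to \<open>\<Lambda>_Re\<close>.\<close>
    have "\<Lambda> (\<lambda>x. Im (f x)) = \<Lambda> (\<lambda>x. Re (- \<i> * f x))" by simp
    also have "\<dots> = Im (\<phi> f)"
      using \<Lambda>_Re[OF A_scale[OF f, of "- \<i>"]] M_A_scale[OF \<phi> f, of "- \<i>"] by simp
    finally show ?thesis using \<Lambda>_Re[OF f] by simp
  qed
  ultimately show ?thesis by blast
qed

end

section \<open>Representing measures and convolution\<close>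

lemma positive_variation_measure:
  fixes M :: "'a::topological_space measure"
  assumes "finite_measure M" and M: "sets M = sets borel"
  shows "positive_variation (measure M) = M"
proof -
  interpret finite_measure M by fact
  have space: "space M = UNIV" using sets_eq_imp_space_eq[OF M] by simp
  have "positive_variation (measure M) = measure_of UNIV (sets borel) (emeasure M)"
    unfolding positive_variation_def
  proof (rule measure_of_eq)
    fix E :: "'a set" assume "E \<in> sigma_sets UNIV (sets borel)"
    then have E: "E \<in> sets borel" using sets.sigma_sets_eq[of "borel :: 'a measure"] by simp
    show "(SUP B\<in>{B \<in> sets borel. B \<subseteq> E}. ennreal (measure M B)) = emeasure M E"
      unfolding emeasure_eq_measure[symmetric]
      using E by (intro antisym SUP_least SUP_upper2[of E]) (auto intro!: emeasure_mono simp: M)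
  qed auto
  also have "\<dots> = M" using measure_of_of_measure[of M] by (simp add: M space)
  finally show ?thesis .
qed

lemma positive_variation_nonpos:
  fixes r :: "'a::topological_space set \<Rightarrow> real"
  assumes "\<And>E. r E \<le> 0"
  shows "positive_variation r = null_measure borel"
proof -
  have "(SUP B\<in>{B \<in> sets borel. B \<subseteq> E}. ennreal (r B)) = 0" for E
  proof -
    have "(SUP B\<in>{B \<in> sets borel. B \<subseteq> E}. ennreal (r B)) = (SUP B\<in>{B \<in> sets borel. B \<subseteq> E}. 0)"
      using assms by (intro SUP_cong) (auto simp: ennreal_eq_0_iff)
    also have "\<dots> = 0" by (intro SUP_eq_const) auto
    finally show ?thesis .
  qed
  then show ?thesis by (simp add: positive_variation_def null_measure_def)
qed

text \<open>For a positive measure three of the four integrals in the definition are taken against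
  the null measure.\<close>

lemma complex_integral_measure:
  fixes M :: "'a::topological_space measure"
  assumes "finite_measure M" "sets M = sets borel"
  shows "complex_integral (\<lambda>E. complex_of_real (measure M E)) f = integral\<^sup>L M f"
  by (simp add: complex_integral_def signed_integral_def positive_variation_measure assms
      positive_variation_nonpos)

lemma total_variation_measure_le:
  fixes M :: "'a::topological_space measure"
  assumes "finite_measure M" and M: "sets M = sets borel" and E: "E \<in> sets borel"
  shows "total_variation (\<lambda>E. complex_of_real (measure M E)) E \<le> emeasure M E"
  unfolding total_variation_def
proof (rule SUP_least)
  interpret finite_measure M by fact
  fix P :: "'a set set" assume "P \<in> {P. finite P \<and> disjoint P \<and> P \<subseteq> sets borel \<and> \<Union>P \<subseteq> E}"
  then have P: "finite P" "disjoint P" "P \<subseteq> sets borel" "\<Union>P \<subseteq> E" by auto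
  have "(\<Sum>B\<in>P. ennreal (cmod (complex_of_real (measure M B)))) = (\<Sum>B\<in>P. emeasure M B)"
    by (simp add: emeasure_eq_measure)
  also have "\<dots> = emeasure M (\<Union>B\<in>P. B)"
    using P by (intro sum_emeasure[of "\<lambda>B. B"]) (auto simp: M disjoint_family_on_def disjoint_def)
  also have "\<dots> \<le> emeasure M E" using P E by (intro emeasure_mono) (auto simp: M)
  finally show "(\<Sum>B\<in>P. ennreal (cmod (complex_of_real (measure M B)))) \<le> emeasure M E" .
qed

lemma regular_complex_measure_of_real:
  fixes M :: "'a::t2_space measure"
  assumes "finite_measure M" and M: "sets M = sets borel"
    and reg: "\<And>E e. E \<in> sets borel \<Longrightarrow> 0 < e \<Longrightarrow>
      \<exists>K U. compact K \<and> open U \<and> K \<subseteq> E \<and> E \<subseteq> U \<and> measure M (U - K) < e"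
  shows "regular_complex_measure (\<lambda>E. complex_of_real (measure M E))"
proof -
  interpret finite_measure M by fact
  have "complex_borel_measure (\<lambda>E. complex_of_real (measure M E))"
    unfolding complex_borel_measure_def
  proof (intro allI impI)
    fix E :: "nat \<Rightarrow> 'a set" assume "range E \<subseteq> sets borel \<and> disjoint_family E"
    then show "(\<lambda>i. complex_of_real (measure M (E i))) sums complex_of_real (measure M (\<Union>i. E i))"
      using finite_measure_UNION[of E] by (simp add: M sums_of_real)
  qed
  moreover have "\<exists>K U. compact K \<and> open U \<and> K \<subseteq> E \<and> E \<subseteq> U \<and>
      total_variation (\<lambda>E. complex_of_real (measure M E)) (U - K) < e"
    if E: "E \<in> sets borel" and e: "0 < e" for E and e :: ennreal
  proof -
    \<comment> \<open>The tolerance \<open>e\<close> is an \<open>ennreal\<close> and may be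
      infinite; a positive real below it is what \<open>reg\<close> accepts.\<close>
    obtain r where r: "0 < r" "ennreal r \<le> e"
    proof (cases e rule: ennreal_cases)
      case (real r)
      then show ?thesis using that[of r] e by auto
    next
      case top
      then show ?thesis using that[of 1] by auto
    qed
    obtain K U where KU: "compact K" "open U" "K \<subseteq> E" "E \<subseteq> U" "measure M (U - K) < r"
      using reg[OF E r(1)] by blast
    have "U - K \<in> sets borel" using KU by (intro sets.Diff borel_open borel_closed compact_imp_closed)
    then have "total_variation (\<lambda>E. complex_of_real (measure M E)) (U - K) \<le> emeasure M (U - K)"
      by (intro total_variation_measure_le M) unfold_locales
    also have "\<dots> < ennreal r"
      using KU(5) r(1) by (simp add: emeasure_eq_measure ennreal_lessI)
    finally show ?thesis using KU(1-4) r(2) by (meson less_le_trans)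
  qed
  ultimately show ?thesis by (simp add: regular_complex_measure_def)
qed

text \<open>The weights are the masses of the disjointed cover. They depend on \<open>M\<close> and
  \<open>V\<close> only, so one choice of \<open>w\<close> serves all integrands \<open>F\<close>,
  values \<open>z\<close> and errors \<open>e\<close>.\<close>

lemma partition_approx:
  fixes V :: "nat \<Rightarrow> 'a::topological_space set" and M :: "'a measure"
  assumes "prob_space M" and M: "sets M = sets borel"
    and V: "\<And>i. open (V i)" "(\<Union>i<n. V i) = UNIV"
  shows "\<exists>w. \<forall>F z e. integrable M F \<longrightarrow> (\<forall>i<n. \<forall>x\<in>V i. norm (F x - z i) \<le> e) \<longrightarrow>
    norm (integral\<^sup>L M F - (\<Sum>i<n. complex_of_real (w i) * z i)) \<le> e"
proof -
  interpret prob_space M by fact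
  define B where "B = disjointed V"
  have B: "B i \<in> sets M" for i
  proof -
    have "range V \<subseteq> sets M" using V(1) by (auto simp: M)
    then show ?thesis unfolding B_def using sets.range_disjointed_sets by blast
  qed
  have pick: "\<exists>k<n. x \<in> V k \<and> (\<forall>i<n. x \<in> B i \<longleftrightarrow> i = k)" for x
  proof -
    have "x \<in> (\<Union>i\<in>{0..<n}. B i)"
      unfolding B_def finite_UN_disjointed_eq using V(2) by (auto simp: atLeast0LessThan)
    then obtain k where k: "k < n" "x \<in> B k" by auto
    then have "i = k" if "x \<in> B i" for i
      using that disjoint_family_disjointed[of V] by (auto simp: B_def disjoint_family_on_def)
    moreover have "x \<in> V k" using k disjointed_subset[of V k] by (auto simp: B_def)
    ultimately show ?thesis using k by blast
  qed
  show ?thesis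
  proof (intro exI[of _ "\<lambda>i. prob (B i)"] allI impI)
    fix F :: "'a \<Rightarrow> complex" and z e
    assume F: "integrable M F" and Fz: "\<forall>i<n. \<forall>x\<in>V i. norm (F x - z i) \<le> e"
    define G where "G x = (\<Sum>i<n. indicator (B i) x *\<^sub>R z i)" for x
    have ind: "integrable M (\<lambda>x. indicator (B i) x *\<^sub>R z i)" for i
      using B by (intro integrable_scaleR_left integrable_real_indicator) (auto simp: emeasure_eq_measure)
    have G: "integrable M G" unfolding G_def by (intro Bochner_Integration.integrable_sum ind)
    have "integral\<^sup>L M G = (\<Sum>i<n. complex_of_real (prob (B i)) * z i)"
    proof -
      have "integral\<^sup>L M G = (\<Sum>i<n. \<integral>x. indicator (B i) x *\<^sub>R z i \<partial>M)"
        unfolding G_def by (rule Bochner_Integration.integral_sum[OF ind])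
      also have "\<dots> = (\<Sum>i<n. prob (B i) *\<^sub>R z i)"
        using B by (intro sum.cong refl, subst integral_scaleR_left)
          (auto simp: emeasure_eq_measure intro: integrable_real_indicator)
      finally show ?thesis by (simp add: scaleR_conv_of_real)
    qed
    moreover have "norm (F x - G x) \<le> e" for x
    proof -
      obtain k where k: "k < n" "x \<in> V k" "\<forall>i<n. x \<in> B i \<longleftrightarrow> i = k" using pick by blast
      have "G x = (\<Sum>i<n. if i = k then z i else 0)"
        unfolding G_def using k(3) by (intro sum.cong) (auto simp: indicator_def)
      then have "G x = z k" using k(1) by simp
      then show ?thesis using Fz k by auto
    qed
    then have "(\<integral>x. norm (F x - G x) \<partial>M) \<le> (\<integral>x. e \<partial>M)"
      using F G by (intro Bochner_Integration.integral_mono) auto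
    moreover have "norm (integral\<^sup>L M (\<lambda>x. F x - G x)) \<le> (\<integral>x. norm (F x - G x) \<partial>M)"
      by (rule Bochner_Integration.integral_norm_bound)
    ultimately show "norm (integral\<^sup>L M F - (\<Sum>i<n. complex_of_real (prob (B i)) * z i)) \<le> e"
      using F G prob_space by simp
  qed
qed

context compact_invariant
begin

text \<open>The probability measure feeds the approximation by finite sums; read as a regular
  complex measure it shows that extending measures exist, so the condition under \<open>THE\<close>
  in \<open>convolution\<close> is not vacuous.\<close>

lemma ex_measure:
  assumes \<phi>: "\<phi> \<in> M_A"
  shows "\<exists>M. prob_space M \<and> sets M = sets borel \<and> (\<forall>f\<in>A. integrable M f \<and> \<phi> f = integral\<^sup>L M f) \<and>
    extending_measure A \<phi> (\<lambda>E. complex_of_real (measure M E))"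
proof -
  obtain \<Lambda> where "state \<Lambda>"
    and \<Lambda>: "\<And>f. f \<in> A \<Longrightarrow> \<phi> f = Complex (\<Lambda> (\<lambda>x. Re (f x))) (\<Lambda> (\<lambda>x. Im (f x)))"
    using ex_state[OF \<phi>] by blast
  interpret state \<Lambda> by fact
  interpret M: prob_space riesz_measure by (rule prob_space_riesz_measure)
  have f: "integrable riesz_measure f \<and> \<phi> f = integral\<^sup>L riesz_measure f" if "f \<in> A" for f
  proof
    have Re_cont: "continuous_on UNIV (\<lambda>x. Re (f x))" and Im_cont: "continuous_on UNIV (\<lambda>x. Im (f x))"
      by (auto intro!: continuous_intros A_cont that)
    have "integrable riesz_measure (\<lambda>x. complex_of_real (Re (f x)) + \<i> * complex_of_real (Im (f x)))"
      using integrable_riesz_measure[OF Re_cont] integrable_riesz_measure[OF Im_cont] by simp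
    then show int: "integrable riesz_measure f" by (simp flip: complex_eq)
    show "\<phi> f = integral\<^sup>L riesz_measure f"
      using integral_riesz_measure[OF Re_cont] integral_riesz_measure[OF Im_cont] int
      by (simp add: \<Lambda>[OF that] complex_eq_iff)
  qed
  have "regular_complex_measure (\<lambda>E. complex_of_real (measure riesz_measure E))"
  proof (rule regular_complex_measure_of_real)
    fix E :: "'g set" and e :: real assume "E \<in> sets borel" "0 < e"
    then obtain K U where "compact K" "open U" "K \<subseteq> E" "E \<subseteq> U" "measure riesz_measure (U - K) < e"
      by (rule riesz_measure_regular)
    then show "\<exists>K U. compact K \<and> open U \<and> K \<subseteq> E \<and> E \<subseteq> U \<and> measure riesz_measure (U - K) < e"
      by blast
  qed (auto intro: M.finite_measure_axioms)
  then have "extending_measure A \<phi> (\<lambda>E. complex_of_real (measure riesz_measure E))"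
    using f by (simp add: extending_measure_def complex_integral_measure M.finite_measure_axioms)
  then show ?thesis using f M.prob_space_axioms by (intro exI[of _ riesz_measure]) auto
qed

section \<open>Finite sums approximating functionals, and the exchange of averages\<close>

lemma uniform_nbhd:
  fixes k :: "'g \<Rightarrow> 'g \<Rightarrow> 'b::real_normed_vector"
  assumes "continuous_on UNIV (\<lambda>(u, x). k u x)" "0 < e"
  shows "\<exists>U. open U \<and> a \<in> U \<and> (\<forall>u\<in>U. \<forall>x. norm (k u x - k a x) \<le> e)"
proof -
  define W where "W = {p :: 'g \<times> 'g. norm (k (fst p) (snd p) - k a (snd p)) < e}"
  have k: "continuous_on UNIV (\<lambda>p. k (fst p) (snd p))"
    using assms(1) by (simp add: case_prod_unfold)
  have "continuous_on UNIV (\<lambda>p :: 'g \<times> 'g. k a (snd p))"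
    using continuous_on_compose2[OF k, of UNIV "\<lambda>p. (a, snd p)"] by (simp add: continuous_intros)
  then have "open W"
    unfolding W_def by (intro open_Collect_less continuous_intros k)
  moreover have "{a} \<times> UNIV \<subseteq> W" using assms(2) by (auto simp: W_def)
  ultimately obtain U where "a \<in> U" "open U" "U \<times> UNIV \<subseteq> W"
    using Elementary_Topology.tube_lemma[OF compact_UNIV, of W a] by blast
  moreover have "norm (k u x - k a x) \<le> e" if "u \<in> U" for u x
  proof -
    have "(u, x) \<in> W" using that \<open>U \<times> UNIV \<subseteq> W\<close> by auto
    then show ?thesis by (simp add: W_def)
  qed
  ultimately show ?thesis by blast
qed

text \<open>By \<open>uniform_nbhd\<close> the map from \<open>u\<close> to the function
  \<open>k u\<close> is continuous for the sup-norm; compactness then gives finitely many sample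
  points for each tolerance.\<close>

lemma uniform_cover:
  fixes k :: "'g \<Rightarrow> 'g \<Rightarrow> 'b::real_normed_vector"
  assumes k: "continuous_on UNIV (\<lambda>(u, x). k u x)" and e: "0 < e"
  shows "\<exists>n (y :: nat \<Rightarrow> 'g) V. (\<forall>i. open (V i)) \<and> (\<Union>i<n. V i) = UNIV \<and>
    (\<forall>i<n. \<forall>g\<in>V i. \<forall>x. norm (k g x - k (y i) x) \<le> e)"
proof -
  obtain U where U: "\<And>a. open (U a)" "\<And>a. a \<in> U a"
    "\<And>a u x. u \<in> U a \<Longrightarrow> norm (k u x - k a x) \<le> e"
    using uniform_nbhd[OF k e] by metis
  have "UNIV \<subseteq> (\<Union>a\<in>UNIV. U a)" using U(2) by blast
  then obtain X where X: "finite X" "UNIV \<subseteq> (\<Union>a\<in>X. U a)"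
    using compactE_image[OF compact_UNIV, of UNIV U] U(1) by auto
  obtain n and y :: "nat \<Rightarrow> 'g" where "X = y ` {i. i < n}"
    using X(1) by (auto simp: finite_conv_nat_seg_image)
  then have "(\<Union>i<n. U (y i)) = UNIV" using X(2) by auto
  then show ?thesis using U(1,3) by (intro exI[of _ n] exI[of _ y] exI[of _ "\<lambda>i. U (y i)"]) auto
qed

lemma cont_add_left: "continuous_on UNIV f \<Longrightarrow> continuous_on UNIV (\<lambda>(u, x). f (u + x :: 'g))"
  for f :: "'g \<Rightarrow> 'b::topological_space"
  unfolding case_prod_unfold by (erule continuous_on_compose2) (auto intro!: continuous_intros)

lemma cont_add_right: "continuous_on UNIV f \<Longrightarrow> continuous_on UNIV (\<lambda>(u, x). f (x + u :: 'g))"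
  for f :: "'g \<Rightarrow> 'b::topological_space"
  unfolding case_prod_unfold by (erule continuous_on_compose2) (auto intro!: continuous_intros)

text \<open>A multiplicative functional is a uniform limit of finite combinations of point evaluations
  on the family of all translates of one function.\<close>

lemma riemann_sums:
  fixes k :: "'g \<Rightarrow> 'g \<Rightarrow> complex"
  assumes \<phi>: "\<phi> \<in> M_A" and k: "continuous_on UNIV (\<lambda>(u, x). k u x)" and e: "0 < e"
  shows "\<exists>n (y :: nat \<Rightarrow> 'g) w. \<forall>F\<in>A.
    (\<forall>g a. (\<forall>x. norm (k g x - k a x) \<le> e) \<longrightarrow> norm (F g - F a) \<le> e) \<longrightarrow>
      norm (\<phi> F - (\<Sum>i<n. complex_of_real (w i) * F (y i))) \<le> e"
proof -
  obtain M where M: "prob_space M" "sets M = sets borel"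
    "\<And>f. f \<in> A \<Longrightarrow> integrable M f \<and> \<phi> f = integral\<^sup>L M f"
    using ex_measure[OF \<phi>] by blast
  obtain n and y :: "nat \<Rightarrow> 'g" and V where V: "\<And>i. open (V i)" "(\<Union>i<n. V i) = UNIV"
    "\<And>i g x. i < n \<Longrightarrow> g \<in> V i \<Longrightarrow> norm (k g x - k (y i) x) \<le> e"
    using uniform_cover[OF k e] by metis
  obtain w where w: "\<And>F z e. integrable M F \<Longrightarrow> (\<forall>i<n. \<forall>x\<in>V i. norm (F x - z i) \<le> e) \<Longrightarrow>
    norm (integral\<^sup>L M F - (\<Sum>i<n. complex_of_real (w i) * z i)) \<le> e"
    using partition_approx[OF M(1,2), of V n] V by blast
  have "norm (\<phi> F - (\<Sum>i<n. complex_of_real (w i) * F (y i))) \<le> e"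
    if "F \<in> A" "\<And>g a. (\<And>x. norm (k g x - k a x) \<le> e) \<Longrightarrow> norm (F g - F a) \<le> e" for F
    using w[of F "\<lambda>i. F (y i)" e] M(3)[OF that(1)] that(2) V(3) by simp
  then show ?thesis by (intro exI[of _ n] exI[of _ y] exI[of _ w]) auto
qed

text \<open>One factor integrated out: the product of \<open>\<phi>\<close> and
  \<open>\<psi>\<close> sends \<open>f\<close> both to \<open>\<psi> (lconv \<phi> f)\<close> and to
  \<open>\<phi> (rconv \<psi> f)\<close>.\<close>

definition lconv :: "(('g \<Rightarrow> complex) \<Rightarrow> complex) \<Rightarrow> ('g \<Rightarrow> complex) \<Rightarrow> 'g \<Rightarrow> complex" where
  "lconv \<phi> f = (\<lambda>h. \<phi> (\<lambda>g. f (g + h)))"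

definition rconv :: "(('g \<Rightarrow> complex) \<Rightarrow> complex) \<Rightarrow> ('g \<Rightarrow> complex) \<Rightarrow> 'g \<Rightarrow> complex" where
  "rconv \<phi> f = (\<lambda>h. \<phi> (\<lambda>g. f (h + g)))"

text \<open>One choice of nodes and weights serves every \<open>h\<close> and every
  \<open>\<psi>\<close>: right translates of \<open>f\<close> and, by \<open>M_A_bound\<close>, the
  functions \<open>rconv \<psi> f\<close> vary between two points by no more than the sup-distance
  of the corresponding left translates of \<open>f\<close>.\<close>

lemma lconv_approx:
  assumes \<phi>: "\<phi> \<in> M_A" and f: "f \<in> A" and e: "0 < e"
  shows "\<exists>n (y :: nat \<Rightarrow> 'g) w. (\<forall>h. norm (lconv \<phi> f h - (\<Sum>i<n. complex_of_real (w i) * f (y i + h))) \<le> e) \<and>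
    (\<forall>\<psi>\<in>M_A. rconv \<psi> f \<in> A \<longrightarrow>
      norm (\<phi> (rconv \<psi> f) - (\<Sum>i<n. complex_of_real (w i) * rconv \<psi> f (y i))) \<le> e)"
proof -
  obtain n and y :: "nat \<Rightarrow> 'g" and w where *: "\<And>F. F \<in> A \<Longrightarrow>
    (\<And>g a. (\<And>x. norm (f (g + x) - f (a + x)) \<le> e) \<Longrightarrow> norm (F g - F a) \<le> e) \<Longrightarrow>
      norm (\<phi> F - (\<Sum>i<n. complex_of_real (w i) * F (y i))) \<le> e"
    using riemann_sums[OF \<phi> cont_add_left[OF A_cont[OF f]] e] by metis
  have "norm (lconv \<phi> f h - (\<Sum>i<n. complex_of_real (w i) * f (y i + h))) \<le> e" for h
    unfolding lconv_def by (rule *[OF A_rtrans[OF f]])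
  moreover have "norm (\<phi> (rconv \<psi> f) - (\<Sum>i<n. complex_of_real (w i) * rconv \<psi> f (y i))) \<le> e"
    if \<psi>: "\<psi> \<in> M_A" and "rconv \<psi> f \<in> A" for \<psi>
  proof (rule *[OF that(2)])
    fix g a assume "\<And>x. norm (f (g + x) - f (a + x)) \<le> e"
    then have "norm (\<psi> (\<lambda>x. f (g + x) - f (a + x))) \<le> e"
      by (intro M_A_bound[OF \<psi>] A_diff A_ltrans f)
    then show "norm (rconv \<psi> f g - rconv \<psi> f a) \<le> e"
      unfolding rconv_def using M_A_diff[OF \<psi> A_ltrans[OF f] A_ltrans[OF f]] by simp
  qed
  ultimately show ?thesis by blast
qed

lemma lconv_A:
  assumes \<phi>: "\<phi> \<in> M_A" and f: "f \<in> A"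
  shows "lconv \<phi> f \<in> A"
proof (rule A_uniform_limit)
  fix e :: real assume "0 < e"
  then obtain n and y :: "nat \<Rightarrow> 'g" and w where
    "\<forall>h. norm (lconv \<phi> f h - (\<Sum>i<n. complex_of_real (w i) * f (y i + h))) \<le> e"
    using lconv_approx[OF \<phi> f] by blast
  then show "\<exists>g\<in>A. \<forall>h. norm (lconv \<phi> f h - g h) \<le> e"
    by (intro bexI[of _ "\<lambda>h. \<Sum>i<n. complex_of_real (w i) * f (y i + h)"] A_sum A_scale A_ltrans f) auto
qed

lemma rconv_A:
  assumes \<phi>: "\<phi> \<in> M_A" and f: "f \<in> A"
  shows "rconv \<phi> f \<in> A"
proof (rule A_uniform_limit)
  fix e :: real assume e: "0 < e"
  obtain n and y :: "nat \<Rightarrow> 'g" and w where *: "\<And>F. F \<in> A \<Longrightarrow>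
    (\<And>g a. (\<And>x. norm (f (x + g) - f (x + a)) \<le> e) \<Longrightarrow> norm (F g - F a) \<le> e) \<Longrightarrow>
      norm (\<phi> F - (\<Sum>i<n. complex_of_real (w i) * F (y i))) \<le> e"
    using riemann_sums[OF \<phi> cont_add_right[OF A_cont[OF f]] e] by metis
  have "norm (rconv \<phi> f h - (\<Sum>i<n. complex_of_real (w i) * f (h + y i))) \<le> e" for h
    unfolding rconv_def by (rule *[OF A_ltrans[OF f]])
  then show "\<exists>g\<in>A. \<forall>h. norm (rconv \<phi> f h - g h) \<le> e"
    by (intro bexI[of _ "\<lambda>h. \<Sum>i<n. complex_of_real (w i) * f (h + y i)"] A_sum A_scale A_rtrans f) auto
qed

text \<open>No product measure is involved: \<open>lconv \<phi> f\<close> is uniformly close to a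
  finite combination of left translates of \<open>f\<close>. Applying \<open>\<psi>\<close> to that
  combination gives exactly the finite sum that approximates the other side.\<close>

lemma fubini:
  assumes \<phi>: "\<phi> \<in> M_A" and \<psi>: "\<psi> \<in> M_A" and f: "f \<in> A"
  shows "\<psi> (lconv \<phi> f) = \<phi> (rconv \<psi> f)"
proof -
  have "norm (\<psi> (lconv \<phi> f) - \<phi> (rconv \<psi> f)) \<le> 0"
  proof (rule field_le_epsilon)
    fix e :: real assume "0 < e"
    then obtain n and y :: "nat \<Rightarrow> 'g" and w where
      1: "\<forall>h. norm (lconv \<phi> f h - (\<Sum>i<n. complex_of_real (w i) * f (y i + h))) \<le> e / 2" and
      "\<forall>\<psi>\<in>M_A. rconv \<psi> f \<in> A \<longrightarrow>
        norm (\<phi> (rconv \<psi> f) - (\<Sum>i<n. complex_of_real (w i) * rconv \<psi> f (y i))) \<le> e / 2"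
      using lconv_approx[OF \<phi> f half_gt_zero] by blast
    then have 2: "norm (\<phi> (rconv \<psi> f) - (\<Sum>i<n. complex_of_real (w i) * rconv \<psi> f (y i))) \<le> e / 2"
      using \<psi> rconv_A[OF \<psi> f] by blast
    let ?S = "\<lambda>h. \<Sum>i<n. complex_of_real (w i) * f (y i + h)"
    have S: "?S \<in> A" by (intro A_sum A_scale A_ltrans f) auto
    have "\<psi> ?S = (\<Sum>i<n. complex_of_real (w i) * rconv \<psi> f (y i))"
      unfolding rconv_def
      by (subst M_A_sum[OF \<psi>]) (auto intro!: A_scale A_ltrans f simp: M_A_scale[OF \<psi> A_ltrans[OF f]])
    moreover have "norm (\<psi> (\<lambda>h. lconv \<phi> f h - ?S h)) \<le> e / 2"
      by (intro M_A_bound[OF \<psi>] A_diff lconv_A \<phi> f S 1[rule_format])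
    ultimately have "norm (\<psi> (lconv \<phi> f) - (\<Sum>i<n. complex_of_real (w i) * rconv \<psi> f (y i))) \<le> e / 2"
      using M_A_diff[OF \<psi> lconv_A[OF \<phi> f] S] by simp
    then show "norm (\<psi> (lconv \<phi> f) - \<phi> (rconv \<psi> f)) \<le> 0 + e"
      using 2 by norm
  qed
  then show ?thesis by simp
qed

section \<open>The convolution semigroup and its point evaluations\<close>

abbreviation conv (infixl "\<star>" 70) where "\<phi> \<star> \<psi> \<equiv> convolution A \<phi> \<psi>"

text \<open>Independence of the extending measures: the inner integrand is a translate of
  \<open>f\<close> and the outer one is \<open>lconv \<phi> f\<close>. Both lie in \<open>A\<close>,
  where the measures only reproduce \<open>\<phi>\<close> and \<open>\<psi>\<close>.\<close>

lemma conv_apply: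
  assumes \<phi>: "\<phi> \<in> M_A" and \<psi>: "\<psi> \<in> M_A" and f: "f \<in> A"
  shows "(\<phi> \<star> \<psi>) f = \<psi> (lconv \<phi> f)"
proof -
  obtain \<mu> \<nu> where ext: "extending_measure A \<phi> \<mu>" "extending_measure A \<psi> \<nu>"
    using ex_measure[OF \<phi>] ex_measure[OF \<psi>] by blast
  have "complex_integral \<nu> (\<lambda>h. complex_integral \<mu> (\<lambda>g. f (g + h))) = \<psi> (lconv \<phi> f)"
    if "extending_measure A \<phi> \<mu>" "extending_measure A \<psi> \<nu>" for \<mu> \<nu>
  proof -
    have "(\<lambda>h. complex_integral \<mu> (\<lambda>g. f (g + h))) = lconv \<phi> f"
      using that(1) A_rtrans[OF f] by (auto simp: extending_measure_def lconv_def)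
    then show ?thesis using that(2) lconv_A[OF \<phi> f] by (simp add: extending_measure_def)
  qed
  then have "(THE z. \<forall>\<mu> \<nu>. extending_measure A \<phi> \<mu> \<and> extending_measure A \<psi> \<nu> \<longrightarrow>
        z = complex_integral \<nu> (\<lambda>h. complex_integral \<mu> (\<lambda>g. f (g + h)))) = \<psi> (lconv \<phi> f)"
    using ext by (intro the_equality) auto
  then show ?thesis using f by (simp add: convolution_def)
qed

lemma conv_apply': "\<phi> \<in> M_A \<Longrightarrow> \<psi> \<in> M_A \<Longrightarrow> f \<in> A \<Longrightarrow> (\<phi> \<star> \<psi>) f = \<phi> (rconv \<psi> f)"
  using conv_apply fubini by simp

lemma M_A_I:
  assumes "\<phi> \<in> extensional A"
    and "\<And>f g. f \<in> A \<Longrightarrow> g \<in> A \<Longrightarrow> \<phi> (\<lambda>x. f x + g x) = \<phi> f + \<phi> g"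
    and "\<And>c f. f \<in> A \<Longrightarrow> \<phi> (\<lambda>x. c * f x) = c * \<phi> f"
    and "\<And>f g. f \<in> A \<Longrightarrow> g \<in> A \<Longrightarrow> \<phi> (\<lambda>x. f x * g x) = \<phi> f * \<phi> g"
    and "\<phi> (\<lambda>x. 1) = 1"
  shows "\<phi> \<in> M_A"
  using assms A_const[of 1] unfolding mult_functionals_def by (auto intro!: bexI[of _ "\<lambda>x. 1"])

lemma conv_M_A:
  assumes \<phi>: "\<phi> \<in> M_A" and \<psi>: "\<psi> \<in> M_A"
  shows "\<phi> \<star> \<psi> \<in> M_A"
proof (rule M_A_I)
  fix f g assume f: "f \<in> A" and g: "g \<in> A"
  have "lconv \<phi> (\<lambda>x. f x + g x) = (\<lambda>h. lconv \<phi> f h + lconv \<phi> g h)"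
    unfolding lconv_def by (auto simp: M_A_add[OF \<phi> A_rtrans[OF f] A_rtrans[OF g]])
  then show "(\<phi> \<star> \<psi>) (\<lambda>x. f x + g x) = (\<phi> \<star> \<psi>) f + (\<phi> \<star> \<psi>) g"
    by (simp add: conv_apply \<phi> \<psi> f g A_add M_A_add lconv_A)
  have "lconv \<phi> (\<lambda>x. f x * g x) = (\<lambda>h. lconv \<phi> f h * lconv \<phi> g h)"
    unfolding lconv_def by (auto simp: M_A_mult[OF \<phi> A_rtrans[OF f] A_rtrans[OF g]])
  then show "(\<phi> \<star> \<psi>) (\<lambda>x. f x * g x) = (\<phi> \<star> \<psi>) f * (\<phi> \<star> \<psi>) g"
    by (simp add: conv_apply \<phi> \<psi> f g A_mult M_A_mult lconv_A)
next
  fix c f assume f: "f \<in> A"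
  have "lconv \<phi> (\<lambda>x. c * f x) = (\<lambda>h. c * lconv \<phi> f h)"
    unfolding lconv_def by (auto simp: M_A_scale[OF \<phi> A_rtrans[OF f]])
  then show "(\<phi> \<star> \<psi>) (\<lambda>x. c * f x) = c * (\<phi> \<star> \<psi>) f"
    by (simp add: conv_apply \<phi> \<psi> f A_scale M_A_scale lconv_A)
next
  show "(\<phi> \<star> \<psi>) (\<lambda>x. 1) = 1"
    by (simp add: conv_apply \<phi> \<psi> A_const lconv_def M_A_one)
qed (simp add: convolution_def)

lemma lconv_conv:
  assumes "\<phi> \<in> M_A" "\<psi> \<in> M_A" "f \<in> A"
  shows "lconv (\<phi> \<star> \<psi>) f = lconv \<psi> (lconv \<phi> f)"
proof
  fix h
  have "lconv (\<phi> \<star> \<psi>) f h = \<psi> (lconv \<phi> (\<lambda>g. f (g + h)))"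
    unfolding lconv_def[of "\<phi> \<star> \<psi>"] using assms by (intro conv_apply A_rtrans)
  then show "lconv (\<phi> \<star> \<psi>) f h = lconv \<psi> (lconv \<phi> f) h"
    by (simp add: lconv_def add.assoc)
qed

lemma conv_assoc:
  assumes "\<phi> \<in> M_A" "\<psi> \<in> M_A" "\<theta> \<in> M_A"
  shows "\<phi> \<star> \<psi> \<star> \<theta> = \<phi> \<star> (\<psi> \<star> \<theta>)"
  using assms by (intro M_A_eqI conv_M_A) (simp_all add: conv_apply conv_M_A lconv_A lconv_conv)

text \<open>The point mass at \<open>a\<close>, written with \<delta> in the overview, restricted to
  \<open>A\<close>.\<close>

definition pt :: "'g \<Rightarrow> ('g \<Rightarrow> complex) \<Rightarrow> complex" where
  "pt a = (\<lambda>f\<in>A. f a)"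

lemma pt_apply: "f \<in> A \<Longrightarrow> pt a f = f a"
  by (simp add: pt_def)

lemma pt_M_A: "pt a \<in> M_A"
  by (rule M_A_I) (simp_all add: pt_def A_add A_scale A_mult A_const)

lemma pt_conv: "\<phi> \<in> M_A \<Longrightarrow> f \<in> A \<Longrightarrow> (pt a \<star> \<phi>) f = rconv \<phi> f a"
  by (simp add: conv_apply' pt_M_A pt_apply rconv_A)

lemma conv_pt: "\<phi> \<in> M_A \<Longrightarrow> f \<in> A \<Longrightarrow> (\<phi> \<star> pt a) f = lconv \<phi> f a"
  by (simp add: conv_apply pt_M_A pt_apply lconv_A)

lemma pt_pt: "pt a \<star> pt b = pt (a + b)"
  by (intro M_A_eqI conv_M_A pt_M_A) (simp add: pt_conv pt_M_A rconv_def pt_apply A_ltrans)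

lemma pt_zero_conv: "\<phi> \<in> M_A \<Longrightarrow> pt 0 \<star> \<phi> = \<phi>"
  by (intro M_A_eqI conv_M_A pt_M_A) (simp_all add: pt_conv rconv_def)

lemma conv_pt_zero: "\<phi> \<in> M_A \<Longrightarrow> \<phi> \<star> pt 0 = \<phi>"
  by (intro M_A_eqI conv_M_A pt_M_A) (simp_all add: conv_pt lconv_def)

end

section \<open>Supports and the maximum principle\<close>

context state
begin

text \<open>The topological support of the Riesz measure of \<open>\<Lambda>\<close>, expressed
  through continuous functions alone.\<close>

definition supp :: "'a set" where
  "supp = {s. \<forall>w. continuous_on UNIV w \<and> (\<forall>x. 0 \<le> w x) \<and> \<Lambda> w = 0 \<longrightarrow> w s = 0}"

text \<open>The compact set \<open>K\<close> on which \<open>w \<le> - e\<close> misses the support,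
  so each of its points carries a null function that is positive there. By compactness finitely many
  of them add up to a null function \<open>W\<close> that is positive on all of
  \<open>K\<close>.\<close>

lemma supp_nonneg:
  assumes w: "continuous_on UNIV w" and pos: "\<And>s. s \<in> supp \<Longrightarrow> 0 \<le> w s"
  shows "0 \<le> \<Lambda> w"
proof (rule field_le_epsilon)
  fix e :: real assume e: "0 < e"
  define K where "K = {x. w x \<le> - e}"
  have "closed K" unfolding K_def using w by (intro closed_Collect_le continuous_intros)
  then have K: "compact K" using compact_UNIV closed_Int_compact[of K UNIV] by simp
  have "\<exists>v. continuous_on UNIV v \<and> (\<forall>y. 0 \<le> v y) \<and> \<Lambda> v = 0 \<and> 0 < v x" if "x \<in> K" for x
  proof -
    have "x \<notin> supp" using pos[of x] that e by (auto simp: K_def)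
    then obtain v where v: "continuous_on UNIV v" "\<forall>y. 0 \<le> v y" "\<Lambda> v = 0" "v x \<noteq> 0"
      by (auto simp: supp_def)
    then show ?thesis by (metis order_le_less)
  qed
  then obtain v where v: "\<And>x. x \<in> K \<Longrightarrow> continuous_on UNIV (v x)" "\<And>x y. x \<in> K \<Longrightarrow> 0 \<le> v x y"
    "\<And>x. x \<in> K \<Longrightarrow> \<Lambda> (v x) = 0" "\<And>x. x \<in> K \<Longrightarrow> 0 < v x x"
    by metis
  have "open {y. 0 < v x y}" if "x \<in> K" for x
    using v(1)[OF that] by (intro open_Collect_less continuous_intros)
  moreover have "K \<subseteq> (\<Union>x\<in>K. {y. 0 < v x y})" using v(4) by blast
  ultimately obtain X where X: "X \<subseteq> K" "finite X" "K \<subseteq> (\<Union>x\<in>X. {y. 0 < v x y})"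
    using compactE_image[OF K, of K "\<lambda>x. {y. 0 < v x y}"] by blast
  define W where "W y = (\<Sum>x\<in>X. v x y)" for y
  have contW: "continuous_on UNIV W"
    unfolding W_def using v(1) X(1) by (intro continuous_on_sum) auto
  have W_nonneg: "0 \<le> W y" for y unfolding W_def using v(2) X(1) by (intro sum_nonneg) auto
  have W_pos: "0 < W y" if "y \<in> K" for y
  proof -
    obtain x where "x \<in> X" "0 < v x y" using X(3) \<open>y \<in> K\<close> by blast
    then show ?thesis unfolding W_def using v(2) X by (intro sum_pos2[of X x]) auto
  qed
  have W_zero: "\<Lambda> W = 0"
    unfolding W_def using sum[OF X(2), of v] v(1,3) X(1) by (simp add: subset_iff)
  obtain C where C: "0 < C" "\<forall>x. norm (w x) \<le> C" using compact_UNIV_bounded[OF compact_UNIV w] by blast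
  obtain c where c: "0 < c" "\<And>y. y \<in> K \<Longrightarrow> c \<le> W y"
  proof (cases "K = {}")
    case True
    then show ?thesis using that[of 1] by auto
  next
    case False
    then obtain y where "y \<in> K" "\<forall>x\<in>K. W y \<le> W x"
      using continuous_attains_inf[OF K _ continuous_on_subset[OF contW]] by auto
    then show ?thesis using that[of "W y"] W_pos by auto
  qed
  have cont: "continuous_on UNIV (\<lambda>y. (- (C / c)) * W y)" by (intro continuous_intros contW)
  \<comment> \<open>The factor makes \<open>(C / c) * W\<close> at least \<open>C\<close> on
    \<open>K\<close>, where \<open>w\<close> may fall to \<open>- C\<close>; off \<open>K\<close>,
    \<open>w\<close> exceeds \<open>- e\<close>. Since \<open>\<Lambda> W = 0\<close>, the
    correction costs nothing.\<close>
  have "\<Lambda> (\<lambda>y. - e + (- (C / c)) * W y) \<le> \<Lambda> w"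
  proof (intro mono continuous_intros contW w)
    fix y
    show "- e + - (C / c) * W y \<le> w y"
    proof (cases "y \<in> K")
      case True
      have "C \<le> (C / c) * W y" using c(2)[OF True] c(1) C(1) by (simp add: field_simps)
      moreover have "- C \<le> w y" using C(2)[rule_format, of y] by auto
      ultimately show ?thesis using e by simp
    next
      case False
      moreover have "0 \<le> (C / c) * W y" using W_nonneg C(1) c(1) by simp
      ultimately show ?thesis by (simp add: K_def)
    qed
  qed
  moreover have "\<Lambda> (\<lambda>y. - e + (- (C / c)) * W y) = - e"
    using add[OF continuous_on_const cont, of "- e"] scale[OF contW, of "- (C / c)"] W_zero const
    by simp
  ultimately show "0 \<le> \<Lambda> w + e" by simp
qed

lemma supp_nonempty: "supp \<noteq> {}"
proof
  assume "supp = {}"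
  then have "0 \<le> \<Lambda> (\<lambda>x. - 1)" by (intro supp_nonneg) auto
  then show False by (simp add: const)
qed

lemma supp_const:
  assumes w: "continuous_on UNIV w" and c: "\<And>s. s \<in> supp \<Longrightarrow> w s = c"
  shows "\<Lambda> w = c"
proof -
  have "0 \<le> \<Lambda> (\<lambda>x. w x - c)" "0 \<le> \<Lambda> (\<lambda>x. c - w x)"
    using c by (auto intro!: supp_nonneg continuous_intros w)
  then show ?thesis using diff[OF w continuous_on_const, of c] diff[OF continuous_on_const w, of c]
    by (simp add: const)
qed

text \<open>Here \<open>w\<close> may be negative off the support; its positive part agrees with it
  on the support and so has the same value under \<open>\<Lambda>\<close>. This is the equality case
  of the maximum principle.\<close>

lemma supp_zero:
  assumes w: "continuous_on UNIV w" and pos: "\<And>s. s \<in> supp \<Longrightarrow> 0 \<le> w s"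
    and zero: "\<Lambda> w = 0" and s: "s \<in> supp"
  shows "w s = 0"
proof -
  have cont: "continuous_on UNIV (\<lambda>x. max (w x) 0)" by (intro continuous_intros w)
  have "\<Lambda> (\<lambda>x. max (w x) 0 - w x) = 0"
    using pos by (intro supp_const continuous_intros w) auto
  then have "\<Lambda> (\<lambda>x. max (w x) 0) = 0" using diff[OF cont w] zero by simp
  then have "max (w s) 0 = 0" using s cont by (auto simp: supp_def)
  then show ?thesis using pos[OF s] by simp
qed

end

text \<open>By compactness two multiples \<open>k n\<close> and \<open>l n\<close> with \<open>k < l\<close> are close to each other,
  so \<open>(l - k - 1) n\<close> is close to \<open>- n\<close>.\<close>

lemma closed_subsemigroup_uminus:
  fixes N :: "'g::{topological_group_add, t2_space} set"
  assumes compact: "compact (UNIV :: 'g set)" and N: "closed N" "0 \<in> N"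
    "\<And>x y. x \<in> N \<Longrightarrow> y \<in> N \<Longrightarrow> x + y \<in> N" and n: "n \<in> N"
  shows "- n \<in> N"
proof (rule ccontr)
  assume "- n \<notin> N"
  define s where "s k = ((\<lambda>x. n + x) ^^ k) 0" for k :: nat
  have s_Suc: "s (Suc k) = n + s k" and s_0: "s 0 = 0" for k by (simp_all add: s_def)
  have s_N: "s k \<in> N" for k by (induction k) (auto simp: s_Suc s_0 N n)
  have s_Suc': "s (Suc k) = s k + n" for k
    by (induction k) (simp_all add: s_Suc s_0, metis add.assoc)
  have s_add: "s (k + j) = s k + s j" for k j
    by (induction k) (simp_all add: s_Suc s_0 add.assoc)
  \<comment> \<open>At \<open>a = b = p\<close> the expression equals \<open>- n\<close>, which lies
    in the open complement of \<open>N\<close>; continuity extends this to a neighbourhood.\<close>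
  have "\<exists>U. open U \<and> p \<in> U \<and> (\<forall>a\<in>U. \<forall>b\<in>U. - a + b - n \<notin> N)" for p
  proof -
    define W where "W = {q :: 'g \<times> 'g. - fst q + snd q - n \<in> - N}"
    have "open W"
      unfolding W_def using open_vimage[of "- N" "\<lambda>q. - fst q + snd q - n"] N(1)
      by (simp add: vimage_def continuous_intros open_Compl)
    moreover have "(p, p) \<in> W" using \<open>- n \<notin> N\<close> by (simp add: W_def)
    ultimately obtain S T where "open S" "open T" "(p, p) \<in> S \<times> T" "S \<times> T \<subseteq> W"
      by (rule open_prod_elim)
    then show ?thesis by (intro exI[of _ "S \<inter> T"]) (force simp: W_def)
  qed
  then obtain U where U: "\<And>p. open (U p)" "\<And>p. p \<in> U p"
    "\<And>p a b. a \<in> U p \<Longrightarrow> b \<in> U p \<Longrightarrow> - a + b - n \<notin> N"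
    by metis
  have "UNIV \<subseteq> (\<Union>p\<in>UNIV. U p)" using U(2) by blast
  then obtain X where X: "finite X" "UNIV \<subseteq> (\<Union>p\<in>X. U p)"
    using compactE_image[OF compact, of UNIV U] U(1) by auto
  then have "\<forall>k. \<exists>p\<in>X. s k \<in> U p" by blast
  then obtain x where x: "\<And>k. x k \<in> X" "\<And>k. s k \<in> U (x k)" by metis
  have "finite (range x)" using x(1) X(1) by (auto intro: finite_subset)
  then have "\<not> inj x" using finite_imageD by auto
  then obtain k l where "k < l" "x k = x l" by (metis injI linorder_neqE_nat)
  then obtain d where d: "l = k + Suc d" using less_imp_Suc_add by auto
  have "- s k + s l - n = s d"
    unfolding d s_add s_Suc' by (simp add: add.assoc[symmetric])
  moreover have "- s k + s l - n \<notin> N" using U(3) x(2) \<open>x k = x l\<close> by metis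
  ultimately show False using s_N by simp
qed

text \<open>Maximum principle on the closed semigroup \<open>N\<close> generated by the support: at
  a maximum over \<open>N + h\<close> the average equals the maximum, so translation by the support
  leads to further maxima. As \<open>N\<close> is a group, \<open>h\<close> itself is
  reached.\<close>

lemma mean_value_left:
  fixes r :: "'g::{topological_group_add, t2_space} \<Rightarrow> real"
  assumes "state \<Lambda>" and r: "continuous_on UNIV r"
    and mean: "\<And>h. \<Lambda> (\<lambda>g. r (g + h)) = r h" and s: "s \<in> state.supp \<Lambda>"
  shows "r (s + h) = r h"
proof -
  interpret state \<Lambda> by fact
  define N where "N = \<Inter>{X. closed X \<and> 0 \<in> X \<and> (\<forall>x\<in>X. \<forall>y\<in>X. x + y \<in> X) \<and> supp \<subseteq> X}"
  have N: "closed N" "0 \<in> N" "\<And>x y. x \<in> N \<Longrightarrow> y \<in> N \<Longrightarrow> x + y \<in> N" "supp \<subseteq> N"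
    unfolding N_def by (auto intro: closed_Inter)
  have rt: "continuous_on UNIV (\<lambda>x. r (x + a))" for a
    by (rule continuous_on_compose2[OF r]) (auto intro!: continuous_intros)
  have "compact N" using compact_UNIV closed_Int_compact[OF N(1), of UNIV] by simp
  then obtain n0 where n0: "n0 \<in> N" "\<And>n. n \<in> N \<Longrightarrow> r (n + h) \<le> r (n0 + h)"
    using continuous_attains_sup[of N "\<lambda>x. r (x + h)"] N(2) continuous_on_subset[OF rt]
    by (metis empty_iff subset_UNIV)
  define m where "m = r (n0 + h)"
  \<comment> \<open>\<open>X\<close> collects the elements of \<open>N\<close> whose left
    translation carries maximum points to maximum points. It is a closed semigroup containing
    \<open>0\<close> and the support, hence all of \<open>N\<close>.\<close>
  define X where "X = N \<inter> (\<Inter>n\<in>{n \<in> N. r (n + h) = m}. {x. r (x + (n + h)) = m})"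
  have "closed X"
    unfolding X_def by (intro closed_Int N(1) closed_INT ballI closed_Collect_eq rt continuous_on_const)
  moreover have "0 \<in> X" using N(2) by (auto simp: X_def)
  moreover have "x + y \<in> X" if "x \<in> X" "y \<in> X" for x y
  proof -
    have "r (x + y + (n + h)) = m" if "n \<in> N" "r (n + h) = m" for n
    proof -
      have "y + n \<in> N" "r ((y + n) + h) = m"
        using \<open>y \<in> X\<close> that N(3) by (auto simp: X_def add.assoc)
      then show ?thesis using \<open>x \<in> X\<close> by (auto simp: X_def add.assoc)
    qed
    then show ?thesis using that N(3) by (auto simp: X_def)
  qed
  moreover have "supp \<subseteq> X"
  proof
    fix t assume t: "t \<in> supp"
    have "m - r (t + (n + h)) = 0" if n: "n \<in> N" "r (n + h) = m" for n
    proof (rule supp_zero[OF _ _ _ t])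
      show "continuous_on UNIV (\<lambda>x. m - r (x + (n + h)))" by (intro continuous_intros rt)
      show "0 \<le> m - r (g + (n + h))" if "g \<in> supp" for g
      proof -
        have "g + n \<in> N" using that n(1) N(3,4) by blast
        then show ?thesis using n0(2)[of "g + n"] by (simp add: m_def add.assoc)
      qed
      show "\<Lambda> (\<lambda>x. m - r (x + (n + h))) = 0"
        using diff[OF continuous_on_const rt, of m "n + h"] mean[of "n + h"] n(2) by (simp add: const)
    qed
    then show "t \<in> X" using t N(4) by (auto simp: X_def)
  qed
  ultimately have "N \<subseteq> X" unfolding N_def by blast
  have *: "r (x + (n0 + h)) = m" if "x \<in> N" for x
    using that \<open>N \<subseteq> X\<close> n0(1) by (auto simp: X_def m_def)
  \<comment> \<open>Both \<open>s + - n0\<close> and \<open>- n0\<close> lie in \<open>N\<close>;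
    applied to the maximum point \<open>n0 + h\<close> they give the values of \<open>r\<close> at
    \<open>s + h\<close> and at \<open>h\<close>.\<close>
  have inv: "- n0 \<in> N" by (rule closed_subsemigroup_uminus[OF compact_UNIV N(1-3) n0(1)])
  then have "s + - n0 \<in> N" using s N(3,4) by blast
  then have "r (s + - n0 + (n0 + h)) = m" by (rule *)
  moreover have "r (- n0 + (n0 + h)) = m" using inv by (rule *)
  moreover have "s + - n0 + (n0 + h) = s + h" "- n0 + (n0 + h) = h"
    by (simp_all only: add.assoc minus_add_cancel)
  ultimately show ?thesis by simp
qed

text \<open>Pushing the state forward under inversion swaps left and right translations and negates
  the support.\<close>

lemma mean_value_right:
  fixes r :: "'g::{topological_group_add, t2_space} \<Rightarrow> real"
  assumes "state \<Lambda>" and r: "continuous_on UNIV r"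
    and mean: "\<And>h. \<Lambda> (\<lambda>g. r (h + g)) = r h" and s: "s \<in> state.supp \<Lambda>"
  shows "r (h + s) = r h"
proof -
  interpret state \<Lambda> by fact
  have refl: "continuous_on UNIV (\<lambda>x. u (- x))" if "continuous_on UNIV u" for u :: "'g \<Rightarrow> real"
    using that by (rule continuous_on_compose2) (auto intro!: continuous_intros)
  define \<Gamma> where "\<Gamma> u = \<Lambda> (\<lambda>x. u (- x))" for u
  interpret \<Gamma>: state \<Gamma>
    by standard (auto simp: \<Gamma>_def one intro!: compact_UNIV add scale nonneg refl)
  have "- s \<in> \<Gamma>.supp"
    using s refl by (force simp: \<Gamma>.supp_def supp_def \<Gamma>_def)
  moreover have "\<Gamma> (\<lambda>g. r (- (g + h))) = r (- h)" for h
    using mean[of "- h"] by (simp add: \<Gamma>_def minus_add)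
  ultimately have "r (- (- s + - h)) = r (- (- h))"
    using mean_value_left[OF \<Gamma>.state_axioms refl[OF r], of "- s" "- h"] by blast
  then show ?thesis by (simp add: minus_add)
qed

section \<open>The maximum principle for functionals\<close>

context compact_invariant
begin

text \<open>A functional on \<open>A\<close> can have several representing states with different
  supports, so the state is carried along explicitly.\<close>

definition represents :: "(('g \<Rightarrow> real) \<Rightarrow> real) \<Rightarrow> (('g \<Rightarrow> complex) \<Rightarrow> complex) \<Rightarrow> bool" where
  "represents \<Lambda> \<phi> \<longleftrightarrow> state \<Lambda> \<and>
     (\<forall>f\<in>A. \<phi> f = Complex (\<Lambda> (\<lambda>x. Re (f x))) (\<Lambda> (\<lambda>x. Im (f x))))"

lemma ex_represents: "\<phi> \<in> M_A \<Longrightarrow> \<exists>\<Lambda>. represents \<Lambda> \<phi>"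
  using ex_state by (simp add: represents_def)

lemma represents_Re: "represents \<Lambda> \<phi> \<Longrightarrow> f \<in> A \<Longrightarrow> Re (\<phi> f) = \<Lambda> (\<lambda>x. Re (f x))"
  and represents_Im: "represents \<Lambda> \<phi> \<Longrightarrow> f \<in> A \<Longrightarrow> Im (\<phi> f) = \<Lambda> (\<lambda>x. Im (f x))"
  and represents_state: "represents \<Lambda> \<phi> \<Longrightarrow> state \<Lambda>"
  by (simp_all add: represents_def)

lemma A_cont_Re: "f \<in> A \<Longrightarrow> continuous_on UNIV (\<lambda>x. Re (f x))"
  and A_cont_Im: "f \<in> A \<Longrightarrow> continuous_on UNIV (\<lambda>x. Im (f x))"
  by (auto intro!: continuous_intros A_cont)

text \<open>The fixed-point equation at left translates of \<open>f\<close> says that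
  \<open>rconv x f\<close> has the mean value property for \<open>\<phi>\<close>;
  \<open>mean_value_right\<close> applies to its real and imaginary parts.\<close>

lemma left_fixed_supp:
  assumes \<phi>: "\<phi> \<in> M_A" and x: "x \<in> M_A" and rep: "represents \<Lambda> \<phi>"
    and fixed: "\<phi> \<star> x = x" and s: "s \<in> state.supp \<Lambda>"
  shows "pt s \<star> x = x"
proof (intro M_A_eqI conv_M_A pt_M_A x)
  fix f assume f: "f \<in> A"
  have F: "rconv x f \<in> A" by (rule rconv_A[OF x f])
  have mean: "rconv x f h = \<phi> (\<lambda>g. rconv x f (h + g))" for h
  proof -
    have "rconv x f h = (\<phi> \<star> x) (\<lambda>g. f (h + g))" by (simp add: fixed rconv_def)
    also have "\<dots> = \<phi> (rconv x (\<lambda>g. f (h + g)))"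
      by (rule conv_apply'[OF \<phi> x A_ltrans[OF f]])
    finally show ?thesis by (simp add: rconv_def add.assoc)
  qed
  have "Re (rconv x f (0 + s)) = Re (rconv x f 0)"
    by (rule mean_value_right[OF represents_state[OF rep] A_cont_Re[OF F] _ s])
      (subst (2) mean, simp add: represents_Re[OF rep A_ltrans[OF F]])
  moreover have "Im (rconv x f (0 + s)) = Im (rconv x f 0)"
    by (rule mean_value_right[OF represents_state[OF rep] A_cont_Im[OF F] _ s])
      (subst (2) mean, simp add: represents_Im[OF rep A_ltrans[OF F]])
  ultimately have "rconv x f s = rconv x f 0" by (simp add: complex_eq_iff)
  then show "(pt s \<star> x) f = x f" by (simp add: pt_conv[OF x f]) (simp add: rconv_def)
qed

lemma right_fixed_supp:
  assumes \<phi>: "\<phi> \<in> M_A" and x: "x \<in> M_A" and rep: "represents \<Lambda> \<phi>"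
    and fixed: "x \<star> \<phi> = x" and s: "s \<in> state.supp \<Lambda>"
  shows "x \<star> pt s = x"
proof (intro M_A_eqI conv_M_A pt_M_A x)
  fix f assume f: "f \<in> A"
  have F: "lconv x f \<in> A" by (rule lconv_A[OF x f])
  have mean: "lconv x f h = \<phi> (\<lambda>g. lconv x f (g + h))" for h
  proof -
    have "lconv x f h = (x \<star> \<phi>) (\<lambda>g. f (g + h))" by (simp add: fixed lconv_def)
    also have "\<dots> = \<phi> (lconv x (\<lambda>g. f (g + h)))"
      by (rule conv_apply[OF x \<phi> A_rtrans[OF f]])
    finally show ?thesis by (simp add: lconv_def add.assoc)
  qed
  have "Re (lconv x f (s + 0)) = Re (lconv x f 0)"
    by (rule mean_value_left[OF represents_state[OF rep] A_cont_Re[OF F] _ s])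
      (subst (2) mean, simp add: represents_Re[OF rep A_rtrans[OF F]])
  moreover have "Im (lconv x f (s + 0)) = Im (lconv x f 0)"
    by (rule mean_value_left[OF represents_state[OF rep] A_cont_Im[OF F] _ s])
      (subst (2) mean, simp add: represents_Im[OF rep A_rtrans[OF F]])
  ultimately have "lconv x f s = lconv x f 0" by (simp add: complex_eq_iff)
  then show "(x \<star> pt s) f = x f" by (simp add: conv_pt[OF x f]) (simp add: lconv_def)
qed

lemma represents_const:
  assumes rep: "represents \<Lambda> \<phi>" and f: "f \<in> A" and c: "\<And>s. s \<in> state.supp \<Lambda> \<Longrightarrow> f s = c"
  shows "\<phi> f = c"
proof -
  interpret state \<Lambda> using rep by (rule represents_state)
  have "\<Lambda> (\<lambda>x. Re (f x)) = Re c" "\<Lambda> (\<lambda>x. Im (f x)) = Im c"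
    using c by (auto intro!: supp_const A_cont_Re A_cont_Im f)
  then show ?thesis using rep f by (simp add: represents_def complex_eq_iff)
qed

text \<open>\<open>\<phi> \<star> x\<close> is the average of the translates
  \<open>pt s \<star> x\<close> over the support of a representing state; here that average is over
  a constant.\<close>

lemma conv_const_left:
  assumes "\<phi> \<in> M_A" "x \<in> M_A" "q \<in> M_A" and rep: "represents \<Lambda> \<phi>"
    and "\<And>s. s \<in> state.supp \<Lambda> \<Longrightarrow> pt s \<star> x = q"
  shows "\<phi> \<star> x = q"
proof (intro M_A_eqI conv_M_A assms(1-3))
  fix f assume f: "f \<in> A"
  have "\<phi> (rconv x f) = q f"
    using assms(5) by (intro represents_const[OF rep] rconv_A assms f) (simp flip: pt_conv[OF assms(2) f])
  then show "(\<phi> \<star> x) f = q f" by (simp add: conv_apply' assms f)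
qed

lemma conv_const_right:
  assumes "\<phi> \<in> M_A" "x \<in> M_A" "q \<in> M_A" and rep: "represents \<Lambda> \<phi>"
    and "\<And>s. s \<in> state.supp \<Lambda> \<Longrightarrow> x \<star> pt s = q"
  shows "x \<star> \<phi> = q"
proof (intro M_A_eqI conv_M_A assms(1-3))
  fix f assume f: "f \<in> A"
  have "\<phi> (lconv x f) = q f"
    using assms(5) by (intro represents_const[OF rep] lconv_A assms f) (simp flip: conv_pt[OF assms(2) f])
  then show "(x \<star> \<phi>) f = q f" by (simp add: conv_apply assms f)
qed

lemma represents_pt: "represents (\<lambda>u. u a) (pt a)"
  and pt_supp: "a \<in> state.supp (\<lambda>u. u (a :: 'g))"
proof -
  interpret state "\<lambda>u. u (a :: 'g)"
    by standard (auto intro: compact_UNIV)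
  show "represents (\<lambda>u. u a) (pt a)"
    using state_axioms by (simp add: represents_def pt_apply)
  show "a \<in> supp" by (simp add: supp_def)
qed

text \<open>\<open>\<Delta>\<close> is the convolution of the two states. If \<open>\<Delta>\<close>
  annihilates a nonnegative \<open>w\<close>, its partial average \<open>P w\<close> vanishes on the
  first support, and then \<open>w (a + b) = 0\<close> for \<open>b\<close> in the second.\<close>

lemma represents_conv:
  assumes \<phi>: "\<phi> \<in> M_A" and \<psi>: "\<psi> \<in> M_A" and rep: "represents \<Lambda> \<phi>" "represents \<Gamma> \<psi>"
  shows "\<exists>\<Delta>. represents \<Delta> (\<phi> \<star> \<psi>) \<and>
    (\<forall>a\<in>state.supp \<Lambda>. \<forall>b\<in>state.supp \<Gamma>. a + b \<in> state.supp \<Delta>)"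
proof -
  interpret \<Lambda>: state \<Lambda> using rep(1) by (rule represents_state)
  interpret \<Gamma>: state \<Gamma> using rep(2) by (rule represents_state)
  define P where "P u a = \<Gamma> (\<lambda>b. u (a + b))" for u and a :: 'g
  define \<Delta> where "\<Delta> u = \<Lambda> (P u)" for u
  have lt: "continuous_on UNIV (\<lambda>x. u (a + x))" if "continuous_on UNIV u" for u :: "'g \<Rightarrow> real" and a
    using that by (rule continuous_on_compose2) (auto intro!: continuous_intros)
  have P_cont: "continuous_on UNIV (P u)" if u: "continuous_on UNIV u" for u
    unfolding continuous_on_def
  proof (intro ballI tendstoI)
    fix a and e :: real assume e: "0 < e"
    obtain U where U: "open U" "a \<in> U" "\<And>g x. g \<in> U \<Longrightarrow> norm (u (g + x) - u (a + x)) \<le> e / 2"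
      using uniform_nbhd[OF cont_add_left[OF u] half_gt_zero[OF e], of a] by blast
    have "dist (P u g) (P u a) < e" if "g \<in> U" for g
    proof -
      have "u (g + x) \<le> u (a + x) + e / 2" "u (a + x) \<le> u (g + x) + e / 2" for x
        using U(3)[OF that, of x] unfolding real_norm_def by linarith+
      then have "P u g \<le> \<Gamma> (\<lambda>x. u (a + x) + e / 2)" "P u a \<le> \<Gamma> (\<lambda>x. u (g + x) + e / 2)"
        unfolding P_def by (auto intro!: \<Gamma>.mono continuous_intros lt[OF u])
      then have "P u g \<le> P u a + e / 2" "P u a \<le> P u g + e / 2"
        by (simp_all add: P_def \<Gamma>.add[OF lt[OF u] continuous_on_const] \<Gamma>.const)
      then show ?thesis using e by (simp add: dist_real_def abs_less_iff)
    qed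
    then show "\<forall>\<^sub>F g in at a within UNIV. dist (P u g) (P u a) < e"
      using U(1,2) unfolding eventually_at_topological by blast
  qed
  have "state \<Delta>"
  proof
    fix u v :: "'g \<Rightarrow> real" assume u: "continuous_on UNIV u" and v: "continuous_on UNIV v"
    have "P (\<lambda>x. u x + v x) = (\<lambda>a. P u a + P v a)"
      by (auto simp: P_def \<Gamma>.add[OF lt[OF u] lt[OF v]])
    then show "\<Delta> (\<lambda>x. u x + v x) = \<Delta> u + \<Delta> v"
      using \<Lambda>.add[OF P_cont[OF u] P_cont[OF v]] by (simp add: \<Delta>_def)
  next
    fix u :: "'g \<Rightarrow> real" and c assume u: "continuous_on UNIV u"
    have "P (\<lambda>x. c * u x) = (\<lambda>a. c * P u a)"
      by (auto simp: P_def \<Gamma>.scale[OF lt[OF u]])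
    then show "\<Delta> (\<lambda>x. c * u x) = c * \<Delta> u"
      using \<Lambda>.scale[OF P_cont[OF u]] by (simp add: \<Delta>_def)
  next
    fix u :: "'g \<Rightarrow> real" assume u: "continuous_on UNIV u" "\<And>x. 0 \<le> u x"
    have "0 \<le> P u a" for a unfolding P_def by (intro \<Gamma>.nonneg lt u)
    then show "0 \<le> \<Delta> u" unfolding \<Delta>_def by (intro \<Lambda>.nonneg P_cont u)
  next
    show "\<Delta> (\<lambda>x. 1) = 1" by (simp add: \<Delta>_def P_def[abs_def] \<Gamma>.const \<Lambda>.const)
  qed (rule compact_UNIV)
  then interpret \<Delta>: state \<Delta> .
  have "represents \<Delta> (\<phi> \<star> \<psi>)"
    unfolding represents_def
  proof (intro conjI ballI \<Delta>.state_axioms)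
    fix f assume f: "f \<in> A"
    have "\<Delta> (\<lambda>x. Re (f x)) = \<Lambda> (\<lambda>a. Re (rconv \<psi> f a))" "\<Delta> (\<lambda>x. Im (f x)) = \<Lambda> (\<lambda>a. Im (rconv \<psi> f a))"
      by (simp_all add: \<Delta>_def P_def[abs_def] rconv_def represents_Re[OF rep(2)] represents_Im[OF rep(2)]
          A_ltrans[OF f])
    then show "(\<phi> \<star> \<psi>) f = Complex (\<Delta> (\<lambda>x. Re (f x))) (\<Delta> (\<lambda>x. Im (f x)))"
      using rep(1) rconv_A[OF \<psi> f] by (simp add: conv_apply' \<phi> \<psi> f represents_def)
  qed
  moreover have "a + b \<in> \<Delta>.supp" if a: "a \<in> \<Lambda>.supp" and b: "b \<in> \<Gamma>.supp" for a b
    unfolding \<Delta>.supp_def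
  proof (intro CollectI allI impI)
    fix w assume w: "continuous_on UNIV w \<and> (\<forall>x. 0 \<le> w x) \<and> \<Delta> w = 0"
    then have "0 \<le> P w a" for a unfolding P_def by (intro \<Gamma>.nonneg lt) auto
    then have "P w a = 0" using a w P_cont by (auto simp: \<Lambda>.supp_def \<Delta>_def)
    then show "w (a + b) = 0" using b w lt unfolding \<Gamma>.supp_def P_def by blast
  qed
  ultimately show ?thesis by blast
qed

end

section \<open>Idempotents\<close>

lemma Inter_finite_chain:
  assumes "finite F" "F \<noteq> {}" "\<And>X Y. X \<in> F \<Longrightarrow> Y \<in> F \<Longrightarrow> X \<subseteq> Y \<or> Y \<subseteq> X"
  shows "\<Inter>F \<in> F"
  using assms
proof (induction F rule: finite_ne_induct)
  case (insert X F)
  then have "\<Inter>F \<in> F" by blast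
  then have "X \<subseteq> \<Inter>F \<or> \<Inter>F \<subseteq> X" using insert.prems by blast
  then show ?case using \<open>\<Inter>F \<in> F\<close> by (auto simp: inf.absorb1 inf.absorb2)
qed simp

lemma compact_imp_closed_fun:
  fixes K :: "('a \<Rightarrow> 'b::t2_space) set"
  assumes "compact K"
  shows "closed K"
proof -
  have "Hausdorff_space (product_topology (\<lambda>_ :: 'a. euclidean :: 'b topology) UNIV)"
    by (simp add: Hausdorff_space_product_topology Hausdorff_space_euclidean)
  then show ?thesis
    using compactin_imp_closedin[of euclidean K] assms by (simp add: euclidean_product_topology)
qed

section \<open>Weak-* compactness, one-sided continuity and absorption\<close>

context compact_invariant
begin

text \<open>Banach-Alaoglu via Tychonoff. Coordinates off \<open>A\<close> are pinned to
  \<open>undefined\<close>, so on \<open>M_A\<close> the product topology is the weak-*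
  topology.\<close>

lemma compact_M_A: "compact M_A"
proof -
  define B where "B f = (if f \<in> A then cball 0 (SOME C. \<forall>x. norm (f x) \<le> C) else {undefined :: complex})"
    for f
  have "compactin (product_topology (\<lambda>_. euclidean) UNIV) (PiE UNIV B)"
    unfolding compactin_PiE by (simp add: B_def)
  then have "compact (PiE UNIV B)" by (simp add: euclidean_product_topology)
  moreover have "M_A \<subseteq> PiE UNIV B"
  proof
    fix \<phi> assume \<phi>: "\<phi> \<in> M_A"
    have "\<phi> f \<in> B f" for f
    proof (cases "f \<in> A")
      case True
      have "\<exists>C. \<forall>x. norm (f x) \<le> C" using compact_UNIV_bounded[OF compact_UNIV A_cont[OF True]] by blast
      then have "\<forall>x. norm (f x) \<le> (SOME C. \<forall>x. norm (f x) \<le> C)" by (rule someI_ex)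
      then show ?thesis using M_A_bound[OF \<phi> True] True by (simp add: B_def)
    next
      case False
      then show ?thesis using M_A_extensional[OF \<phi>] by (simp add: B_def extensional_def)
    qed
    then show "\<phi> \<in> PiE UNIV B" by auto
  qed
  moreover have "closed M_A"
  proof -
    \<comment> \<open>Being nonzero is replaced by the value 1 at the constant 1, which is a closed
      condition.\<close>
    have "M_A = (\<Inter>f\<in>-A. {\<phi>. \<phi> f = undefined}) \<inter>
      (\<Inter>f\<in>A. \<Inter>g\<in>A. {\<phi>. \<phi> (\<lambda>x. f x + g x) = \<phi> f + \<phi> g}) \<inter>
      (\<Inter>c. \<Inter>f\<in>A. {\<phi>. \<phi> (\<lambda>x. c * f x) = c * \<phi> f}) \<inter>
      (\<Inter>f\<in>A. \<Inter>g\<in>A. {\<phi>. \<phi> (\<lambda>x. f x * g x) = \<phi> f * \<phi> g}) \<inter> {\<phi>. \<phi> (\<lambda>x. 1) = 1}"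
      (is "_ = ?R")
    proof
      show "M_A \<subseteq> ?R"
        using M_A_extensional by (auto simp: M_A_add M_A_scale M_A_mult M_A_one extensional_def)
      show "?R \<subseteq> M_A"
        by (auto intro!: M_A_I simp: extensional_def)
    qed
    moreover have "closed ?R"
      by (intro closed_Int closed_INT ballI closed_Collect_eq continuous_intros
          continuous_on_product_coordinates)
    ultimately show ?thesis by simp
  qed
  ultimately show ?thesis using closed_Int_compact[of M_A "PiE UNIV B"] by (simp add: Int_absorb2)
qed

lemma closed_M_A: "closed M_A"
  by (rule compact_imp_closed_fun[OF compact_M_A])

lemma closed_eval_eq: "closed {\<phi> \<in> M_A. \<forall>f\<in>A. \<phi> (F f) = c f}"
proof -
  have "{\<phi> \<in> M_A. \<forall>f\<in>A. \<phi> (F f) = c f} = M_A \<inter> (\<Inter>f\<in>A. {\<phi>. \<phi> (F f) = c f})" by auto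
  moreover have "closed \<dots>"
    by (intro closed_Int closed_M_A closed_INT ballI closed_Collect_eq continuous_on_const
        continuous_on_product_coordinates)
  ultimately show ?thesis by simp
qed

lemma conv_eq_iff: "\<phi> \<in> M_A \<Longrightarrow> \<psi> \<in> M_A \<Longrightarrow> q \<in> M_A \<Longrightarrow> \<phi> \<star> \<psi> = q \<longleftrightarrow> (\<forall>f\<in>A. \<phi> (rconv \<psi> f) = q f)"
  by (metis M_A_eqI conv_M_A conv_apply')

lemma conv_eq_iff': "\<phi> \<in> M_A \<Longrightarrow> \<psi> \<in> M_A \<Longrightarrow> q \<in> M_A \<Longrightarrow> \<phi> \<star> \<psi> = q \<longleftrightarrow> (\<forall>f\<in>A. \<psi> (lconv \<phi> f) = q f)"
  by (metis M_A_eqI conv_M_A conv_apply)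

text \<open>For fixed \<open>x\<close>, the value of \<open>t \<star> x\<close> at \<open>f\<close>
  is the coordinate of \<open>t\<close> at \<open>rconv x f\<close>, so the set is cut out by
  coordinate equations.\<close>

lemma closed_conv_left:
  assumes "x \<in> M_A" "q \<in> M_A"
  shows "closed {t \<in> M_A. t \<star> x = q}"
proof -
  have "{t \<in> M_A. t \<star> x = q} = {t \<in> M_A. \<forall>f\<in>A. t (rconv x f) = q f}"
    using conv_eq_iff assms by blast
  then show ?thesis using closed_eval_eq by simp
qed

lemma closed_conv_right:
  assumes "x \<in> M_A" "q \<in> M_A"
  shows "closed {t \<in> M_A. x \<star> t = q}"
proof -
  have "{t \<in> M_A. x \<star> t = q} = {t \<in> M_A. \<forall>f\<in>A. t (lconv x f) = q f}"
    using conv_eq_iff' assms by blast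
  then show ?thesis using closed_eval_eq by simp
qed

lemma continuous_conv_left:
  assumes x: "x \<in> M_A"
  shows "continuous_on M_A (\<lambda>t. t \<star> x)"
proof (rule continuous_on_coordinatewise_then_product)
  fix f
  show "continuous_on M_A (\<lambda>t. (t \<star> x) f)"
  proof (cases "f \<in> A")
    case True
    have "continuous_on M_A (\<lambda>t. t (rconv x f))"
      by (rule continuous_on_subset[OF continuous_on_product_coordinates subset_UNIV])
    then show ?thesis
      by (rule continuous_on_eq) (simp add: conv_apply' x True)
  next
    case False
    then show ?thesis by (simp add: convolution_def)
  qed
qed

text \<open>For a fixed \<open>a\<close> in the support of \<open>t\<close>,
  \<open>pt b \<star> x\<close> is the same \<open>q\<close> for all \<open>b\<close> in the support
  of \<open>j\<close>, so \<open>j \<star> x = q\<close>. Then \<open>j \<star> q = q\<close>, hence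
  \<open>pt s \<star> q = q = pt s \<star> x\<close>, and the invertible \<open>pt s\<close>
  cancels.\<close>

lemma left_fixed_of_factor:
  assumes t: "t \<in> M_A" and j: "j \<in> M_A" "j \<star> j = j" and x: "x \<in> M_A" and eq: "x = t \<star> (j \<star> x)"
  shows "j \<star> x = x"
proof -
  obtain \<Lambda> \<Gamma> where rep: "represents \<Lambda> t" "represents \<Gamma> j" using ex_represents t j by blast
  obtain \<Delta> where \<Delta>: "represents \<Delta> (t \<star> j)"
    "\<And>a b. a \<in> state.supp \<Lambda> \<Longrightarrow> b \<in> state.supp \<Gamma> \<Longrightarrow> a + b \<in> state.supp \<Delta>"
    using represents_conv[OF t j(1) rep] by blast
  obtain a s where a: "a \<in> state.supp \<Lambda>" and s: "s \<in> state.supp \<Gamma>"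
    using rep[THEN represents_state, THEN state.supp_nonempty] by blast
  define q where "q = pt (- a) \<star> x"
  have q: "q \<in> M_A" unfolding q_def by (intro conv_M_A pt_M_A x)
  have fixed: "(t \<star> j) \<star> x = x" using eq by (simp add: conv_assoc t j x)
  have pt_b: "pt b \<star> x = q" if "b \<in> state.supp \<Gamma>" for b
  proof -
    have "pt (a + b) \<star> x = x"
      by (rule left_fixed_supp[OF conv_M_A[OF t j(1)] x \<Delta>(1) fixed \<Delta>(2)[OF a that]])
    then have "pt (- a) \<star> (pt (a + b) \<star> x) = q" by (simp add: q_def)
    then show ?thesis by (simp add: conv_assoc[symmetric] pt_M_A x pt_pt)
  qed
  then have jx: "j \<star> x = q" by (rule conv_const_left[OF j(1) x q rep(2)])
  then have "j \<star> q = q" using conv_assoc[OF j(1) j(1) x] j(2) by simp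
  then have "pt s \<star> q = q" by (rule left_fixed_supp[OF j(1) q rep(2) _ s])
  then have "pt (- s) \<star> (pt s \<star> q) = pt (- s) \<star> (pt s \<star> x)" using pt_b[OF s] by simp
  then have "q = x"
    by (simp add: conv_assoc[symmetric] pt_M_A x q pt_pt pt_zero_conv)
  then show ?thesis using jx by simp
qed

text \<open>For \<open>s\<close> in the support of \<open>j\<close>,
  \<open>pt s \<star> x = x\<close> makes \<open>q = x \<star> pt s\<close> idempotent. With
  \<open>g\<close> in the support of \<open>x\<close>, \<open>q\<close> is fixed on the right by
  \<open>pt (g + s)\<close>; cancelling \<open>s\<close>, and then \<open>g\<close> by
  \<open>x \<star> pt g = x\<close>, leaves \<open>x \<star> pt s = x\<close>.\<close>

lemma left_absorb_imp_right_absorb: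
  assumes j: "j \<in> M_A" and x: "x \<in> M_A" "x \<star> x = x" and eq: "j \<star> x = x"
  shows "x \<star> j = x"
proof -
  obtain \<Lambda> \<Gamma> where rep: "represents \<Lambda> j" "represents \<Gamma> x" using ex_represents j x by blast
  obtain g where g: "g \<in> state.supp \<Gamma>"
    using rep(2)[THEN represents_state, THEN state.supp_nonempty] by blast
  have xg: "x \<star> pt g = x" by (rule right_fixed_supp[OF x(1) x(1) rep(2) x(2) g])
  have move: "x \<star> pt (a + c) = x \<star> pt (b + c)" if "x \<star> pt a = x \<star> pt b" for a b c
    using that by (simp add: pt_pt[symmetric] conv_assoc[symmetric] x pt_M_A)
  have x0: "x \<star> pt 0 = x" by (rule conv_pt_zero[OF x(1)])
  have "x \<star> pt s = x" if s: "s \<in> state.supp \<Lambda>" for s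
  proof -
    have sx: "pt s \<star> x = x" by (rule left_fixed_supp[OF j x(1) rep(1) eq s])
    define q where "q = x \<star> pt s"
    have q: "q \<in> M_A" unfolding q_def by (intro conv_M_A x pt_M_A)
    have "q \<star> q = x \<star> (pt s \<star> x) \<star> pt s"
      by (simp add: q_def conv_assoc conv_M_A x pt_M_A)
    then have qq: "q \<star> q = q" by (simp add: sx x(2) q_def)
    obtain \<Delta> where \<Delta>: "represents \<Delta> q" "g + s \<in> state.supp \<Delta>"
      using represents_conv[OF x(1) pt_M_A rep(2) represents_pt, of s] g pt_supp[of s]
      by (auto simp: q_def)
    have "q \<star> pt (g + s) = q" by (rule right_fixed_supp[OF q q \<Delta>(1) qq \<Delta>(2)])
    then have "x \<star> pt (s + (g + s)) = x \<star> pt s"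
      by (simp add: q_def conv_assoc x pt_M_A pt_pt)
    then have "x \<star> pt (s + (g + s) + - s) = x \<star> pt (s + - s)" by (rule move)
    moreover have "s + (g + s) + - s = s + g" by (simp add: add.assoc[symmetric])
    ultimately have "x \<star> pt (s + g) = x \<star> pt 0" by simp
    then have "x \<star> pt (s + g + - g) = x \<star> pt (0 + - g)" by (rule move)
    moreover have "x \<star> pt (g + - g) = x \<star> pt (0 + - g)" by (rule move) (simp only: xg x0)
    moreover have "s + g + - g = s" "g + - g = 0" by simp_all
    ultimately show ?thesis using x0 by (simp del: add_uminus_conv_diff)
  qed
  then show ?thesis by (rule conv_const_right[OF j x(1) x(1) rep(1)])
qed

section \<open>Minimal left ideals and infima of idempotents\<close>

definition generated :: "(('g \<Rightarrow> complex) \<Rightarrow> complex) set \<Rightarrow> (('g \<Rightarrow> complex) \<Rightarrow> complex) set" where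
  "generated I = \<Inter>{X. closed X \<and> I \<subseteq> X \<and> X \<subseteq> M_A \<and> (\<forall>x\<in>X. \<forall>y\<in>X. x \<star> y \<in> X)}"

lemma generated:
  assumes "I \<subseteq> M_A"
  shows "closed (generated I)" "I \<subseteq> generated I" "generated I \<subseteq> M_A"
    "x \<in> generated I \<Longrightarrow> y \<in> generated I \<Longrightarrow> x \<star> y \<in> generated I"
proof -
  have "M_A \<in> {X. closed X \<and> I \<subseteq> X \<and> X \<subseteq> M_A \<and> (\<forall>x\<in>X. \<forall>y\<in>X. x \<star> y \<in> X)}"
    using assms closed_M_A conv_M_A by auto
  then show "generated I \<subseteq> M_A" unfolding generated_def by (rule Inter_lower)
qed (auto simp: generated_def intro: closed_Inter)

lemma generated_least:
  "closed X \<Longrightarrow> I \<subseteq> X \<Longrightarrow> X \<subseteq> M_A \<Longrightarrow> (\<And>x y. x \<in> X \<Longrightarrow> y \<in> X \<Longrightarrow> x \<star> y \<in> X) \<Longrightarrow> generated I \<subseteq> X"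
  unfolding generated_def by (rule Inter_lower) auto

text \<open>Any element \<open>x\<close> of a minimal closed left ideal \<open>L\<close> works:
  multiplying \<open>y \<star> x\<close> on the left by all of \<open>S\<close> fills
  \<open>L\<close> again.\<close>

lemma minimal_left_ideal:
  assumes S: "closed S" "S \<subseteq> M_A" "S \<noteq> {}" "\<And>x y. x \<in> S \<Longrightarrow> y \<in> S \<Longrightarrow> x \<star> y \<in> S"
  obtains x where "x \<in> S" "\<And>y. y \<in> S \<Longrightarrow> \<exists>t\<in>S. x = t \<star> (y \<star> x)"
proof -
  have cS: "compact S" using closed_Int_compact[OF S(1) compact_M_A] S(2) by (simp add: Int_absorb2)
  define \<L> where "\<L> = {L. closed L \<and> L \<noteq> {} \<and> L \<subseteq> S \<and> (\<forall>t\<in>S. \<forall>x\<in>L. t \<star> x \<in> L)}"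
  have "S \<in> \<L>" using S by (auto simp: \<L>_def)
  have "\<exists>m\<in>\<L>. \<forall>L\<in>\<L>. L \<subseteq> m \<longrightarrow> L = m"
  proof (rule predicate_Zorn)
    show "partial_order_on \<L> (relation_of (\<lambda>X Y. Y \<subseteq> X) \<L>)"
      by (rule partial_order_on_relation_ofI) auto
  next
    fix C assume C: "C \<in> Chains (relation_of (\<lambda>X Y. Y \<subseteq> X) \<L>)"
    then have CL: "C \<subseteq> \<L>" by (auto simp: Chains_def relation_of_def)
    have tot: "X \<subseteq> Y \<or> Y \<subseteq> X" if "X \<in> C" "Y \<in> C" for X Y
      using C that by (auto simp: Chains_def relation_of_def)
    show "\<exists>U\<in>\<L>. \<forall>L\<in>C. U \<subseteq> L"
    proof (cases "C = {}")
      case True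
      then show ?thesis using \<open>S \<in> \<L>\<close> by blast
    next
      case False
      \<comment> \<open>A finite part of a chain contains its own intersection, which is a nonempty
        ideal; compactness of \<open>S\<close> extends this to the whole chain.\<close>
      have "S \<inter> \<Inter>C \<noteq> {}"
      proof (rule compact_imp_fip[OF cS])
        fix T assume "T \<in> C"
        then show "closed T" using CL by (auto simp: \<L>_def)
      next
        fix F assume F: "finite F" "F \<subseteq> C"
        show "S \<inter> \<Inter>F \<noteq> {}"
        proof (cases "F = {}")
          case True
          then show ?thesis using S(3) by simp
        next
          case False
          then have "\<Inter>F \<in> F" using F tot by (intro Inter_finite_chain) auto
          then have "\<Inter>F \<in> \<L>" using F CL by blast
          then show ?thesis by (auto simp: \<L>_def)
        qed
      qed
      then have "\<Inter>C \<noteq> {}" by blast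
      moreover have "\<Inter>C \<subseteq> S" using False CL by (auto simp: \<L>_def)
      moreover have "closed (\<Inter>C)" using CL by (intro closed_Inter) (auto simp: \<L>_def)
      moreover have "\<forall>t\<in>S. \<forall>x\<in>\<Inter>C. t \<star> x \<in> \<Inter>C" using CL by (auto simp: \<L>_def)
      ultimately have "\<Inter>C \<in> \<L>" by (simp add: \<L>_def)
      then show ?thesis by blast
    qed
  qed
  then obtain L where L: "L \<in> \<L>" "\<And>L'. L' \<in> \<L> \<Longrightarrow> L' \<subseteq> L \<Longrightarrow> L' = L" by blast
  then obtain x where x: "x \<in> L" by (auto simp: \<L>_def)
  have xS: "x \<in> S" using x L(1) by (auto simp: \<L>_def)
  have "\<exists>t\<in>S. x = t \<star> (y \<star> x)" if y: "y \<in> S" for y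
  proof -
    have yx: "y \<star> x \<in> L" "y \<star> x \<in> M_A" using x y L(1) S(2) by (auto simp: \<L>_def)
    \<comment> \<open>A left ideal inside \<open>L\<close>, closed because it is a continuous image
      of the compact \<open>S\<close>; minimality makes it equal to \<open>L\<close>.\<close>
    let ?L = "(\<lambda>t. t \<star> (y \<star> x)) ` S"
    have "compact ?L"
      using continuous_on_subset[OF continuous_conv_left[OF yx(2)] S(2)] cS
      by (rule compact_continuous_image)
    then have "closed ?L" by (rule compact_imp_closed_fun)
    moreover have "?L \<subseteq> L" using yx(1) L(1) by (auto simp: \<L>_def)
    moreover have "L \<subseteq> S" using L(1) by (auto simp: \<L>_def)
    moreover have "t \<star> z \<in> ?L" if tz: "t \<in> S" "z \<in> ?L" for t z
    proof -
      obtain u where u: "u \<in> S" "z = u \<star> (y \<star> x)" using tz(2) by blast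
      then have "t \<star> z = (t \<star> u) \<star> (y \<star> x)"
        using tz(1) S(2) yx(2) u by (simp add: conv_assoc subset_iff)
      then show ?thesis using S(4)[OF tz(1) u(1)] by blast
    qed
    ultimately have "?L \<in> \<L>" using S(3) by (auto simp: \<L>_def)
    then have "?L = L" using \<open>?L \<subseteq> L\<close> by (rule L(2))
    then show ?thesis using x by blast
  qed
  then show ?thesis using that xS by blast
qed

lemma idempotentsD: "j \<in> idempotents A \<Longrightarrow> j \<in> M_A" "j \<in> idempotents A \<Longrightarrow> j \<star> j = j"
  by (auto simp: idempotents_def)

theorem ex_infimum:
  assumes I: "I \<subseteq> idempotents A"
  shows "\<exists>x\<in>idempotents A. (\<forall>j\<in>I. x \<star> j = x \<and> j \<star> x = x) \<and>
    (\<forall>q\<in>idempotents A. (\<forall>j\<in>I. q \<star> j = q \<and> j \<star> q = q) \<longrightarrow> q \<star> x = q \<and> x \<star> q = q)"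
proof (cases "I = {}")
  case True
  \<comment> \<open>The infimum of the empty set is the greatest idempotent, the identity
    \<open>pt 0\<close>.\<close>
  then show ?thesis
    by (intro bexI[of _ "pt 0"])
      (auto simp: idempotents_def pt_M_A pt_pt conv_pt_zero pt_zero_conv)
next
  case False
  have IM: "I \<subseteq> M_A" using I idempotentsD by blast
  note S = generated[OF IM]
  obtain x where x: "x \<in> generated I"
    "\<And>y. y \<in> generated I \<Longrightarrow> \<exists>t\<in>generated I. x = t \<star> (y \<star> x)"
    using minimal_left_ideal[OF S(1,3) _ S(4)] S(2) False by blast
  have xM: "x \<in> M_A" using x(1) S(3) by blast
  have jx: "j \<star> x = x" if j: "j \<in> I" for j
  proof -
    have jM: "j \<in> M_A" "j \<star> j = j" using j I idempotentsD by blast+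
    obtain t where "t \<in> generated I" "x = t \<star> (j \<star> x)" using x(2) j S(2) by blast
    then show ?thesis using S(3) by (intro left_fixed_of_factor[OF _ jM xM]) auto
  qed
  \<comment> \<open>The elements fixing \<open>x\<close> from the left form a closed semigroup
    containing \<open>I\<close>, hence contain \<open>x\<close> itself: this is where idempotency
    comes from.\<close>
  have "generated I \<subseteq> {t \<in> M_A. t \<star> x = x}"
    by (rule generated_least[OF closed_conv_left[OF xM xM]])
      (use IM jx xM in \<open>auto simp: conv_M_A conv_assoc\<close>)
  then have xx: "x \<star> x = x" using x(1) by blast
  have "q \<star> x = q \<and> x \<star> q = q" if q: "q \<in> idempotents A" "\<forall>j\<in>I. q \<star> j = q \<and> j \<star> q = q" for q
  proof -
    have qM: "q \<in> M_A" using q(1) idempotentsD by blast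
    \<comment> \<open>A lower bound \<open>q\<close> absorbs each member of \<open>I\<close>; the
      elements absorbed by \<open>q\<close> on either side form closed semigroups, so
      \<open>q\<close> absorbs \<open>x\<close> too.\<close>
    have "generated I \<subseteq> {t \<in> M_A. q \<star> t = q}"
      by (rule generated_least[OF closed_conv_right[OF qM qM]])
        (use IM q(2) qM in \<open>auto simp: conv_M_A simp flip: conv_assoc\<close>)
    moreover have "generated I \<subseteq> {t \<in> M_A. t \<star> q = q}"
      by (rule generated_least[OF closed_conv_left[OF qM qM]])
        (use IM q(2) qM in \<open>auto simp: conv_M_A conv_assoc\<close>)
    ultimately show ?thesis using x(1) by blast
  qed
  moreover have "x \<star> j = x" if "j \<in> I" for j
    using left_absorb_imp_right_absorb[OF _ xM xx jx[OF that]] that IM by blast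
  moreover have "x \<in> idempotents A" using xM xx by (simp add: idempotents_def)
  ultimately show ?thesis using jx by blast
qed

section \<open>Centrality of the least idempotent\<close>

lemma idempotent_conjugate:
  assumes j: "j \<in> idempotents A"
  shows "pt g \<star> j \<star> pt (- g) \<in> idempotents A"
proof -
  have jM: "j \<in> M_A" "j \<star> j = j" using j idempotentsD by blast+
  have "(pt g \<star> j \<star> pt (- g)) \<star> (pt g \<star> j \<star> pt (- g)) =
    pt g \<star> (j \<star> (pt (- g) \<star> pt g) \<star> j) \<star> pt (- g)"
    by (simp add: conv_assoc conv_M_A jM pt_M_A)
  also have "\<dots> = pt g \<star> j \<star> pt (- g)" by (simp add: pt_pt conv_pt_zero jM)
  finally show ?thesis by (simp add: idempotents_def conv_M_A jM pt_M_A)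
qed

text \<open>Conjugation by \<open>pt g\<close> permutes the idempotents. Since \<open>e\<close> lies
  below its conjugate by \<open>- g\<close>, conjugating back puts the conjugate by \<open>g\<close>
  below \<open>e\<close>, and leastness gives equality.\<close>

lemma least_idempotent_central:
  assumes e: "e \<in> idempotents A" and least: "\<And>j. j \<in> idempotents A \<Longrightarrow> e \<star> j = e \<and> j \<star> e = e"
  shows "e \<in> semigroup_centre A"
proof -
  have eM: "e \<in> M_A" using e idempotentsD by blast
  have ge: "pt g \<star> e \<star> pt (- g) = e" for g
  proof -
    have "e = e \<star> (pt (- g) \<star> e \<star> pt (- (- g)))"
      using least[OF idempotent_conjugate[OF e, of "- g"]] by simp
    then have "pt g \<star> e \<star> pt (- g) = pt g \<star> (e \<star> (pt (- g) \<star> e \<star> pt (- (- g)))) \<star> pt (- g)"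
      by simp
    also have "\<dots> = (pt g \<star> e \<star> pt (- g)) \<star> (e \<star> (pt (- (- g)) \<star> pt (- g)))"
      by (simp only: conv_assoc conv_M_A eM pt_M_A)
    also have "\<dots> = (pt g \<star> e \<star> pt (- g)) \<star> e" by (simp add: pt_pt conv_pt_zero eM)
    also have "\<dots> = e" using least[OF idempotent_conjugate[OF e, of g]] by simp
    finally show ?thesis .
  qed
  have comm: "pt g \<star> e = e \<star> pt g" for g
  proof -
    have "e \<star> pt g = (pt g \<star> e \<star> pt (- g)) \<star> pt g" by (simp add: ge)
    also have "\<dots> = pt g \<star> e" by (simp add: conv_assoc conv_M_A eM pt_M_A pt_pt conv_pt_zero)
    finally show ?thesis by simp
  qed
  have "e \<star> \<phi> = \<phi> \<star> e" if \<phi>: "\<phi> \<in> M_A" for \<phi>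
  proof (intro M_A_eqI conv_M_A eM \<phi>)
    fix f assume f: "f \<in> A"
    \<comment> \<open>Commuting with every \<open>pt g\<close> means that the two one-sided averages
      of \<open>f\<close> against \<open>e\<close> agree pointwise; evaluating \<open>\<phi>\<close>
      on them gives the two products.\<close>
    have "lconv e f = rconv e f" using comm by (metis conv_pt[OF eM f] pt_conv[OF eM f] ext)
    then show "(e \<star> \<phi>) f = (\<phi> \<star> e) f" by (simp add: conv_apply[OF eM \<phi> f] conv_apply'[OF \<phi> eM f])
  qed
  then show ?thesis using eM by (simp add: semigroup_centre_def)
qed

section \<open>The order on idempotents and its bounds\<close>

lemma partial_order_idempotents: "partial_order (idempotent_order A)"
proof
  fix x y z
  assume "x \<sqsubseteq>\<^bsub>idempotent_order A\<^esub> y" "y \<sqsubseteq>\<^bsub>idempotent_order A\<^esub> z"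
    and "x \<in> carrier (idempotent_order A)" "y \<in> carrier (idempotent_order A)"
    "z \<in> carrier (idempotent_order A)"
  then have M: "x \<in> M_A" "y \<in> M_A" "z \<in> M_A"
    and xy: "x \<star> y = x" "y \<star> x = x" and yz: "y \<star> z = y" "z \<star> y = y"
    by (auto simp: idempotent_order_def idempotents_def)
  have "x \<star> z = x" using conv_assoc[OF M] xy yz by simp
  moreover have "z \<star> x = x" using conv_assoc[OF M(3,2,1)] xy yz by simp
  ultimately show "x \<sqsubseteq>\<^bsub>idempotent_order A\<^esub> z" by (simp add: idempotent_order_def)
qed (auto simp: idempotent_order_def idempotents_def)

lemma ex_greatest_Lower:
  assumes "I \<subseteq> idempotents A"
  shows "\<exists>i. greatest (idempotent_order A) i (Lower (idempotent_order A) I)"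
proof -
  obtain x where "x \<in> idempotents A" "\<forall>j\<in>I. x \<star> j = x \<and> j \<star> x = x"
    "\<forall>q\<in>idempotents A. (\<forall>j\<in>I. q \<star> j = q \<and> j \<star> q = q) \<longrightarrow> q \<star> x = q \<and> x \<star> q = q"
    using ex_infimum[OF assms] by blast
  then have "greatest (idempotent_order A) x (Lower (idempotent_order A) I)"
    using assms by (auto simp: greatest_def Lower_def idempotent_order_def subset_iff)
  then show ?thesis by blast
qed

text \<open>The infimum of the upper bounds is again an upper bound, because every member of
  \<open>I\<close> is a lower bound of them.\<close>

lemma ex_least_Upper:
  assumes I: "I \<subseteq> idempotents A"
  shows "\<exists>s. least (idempotent_order A) s (Upper (idempotent_order A) I)"
proof -
  let ?L = "idempotent_order A"
  have carrier: "carrier ?L = idempotents A" by (simp add: idempotent_order_def)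
  have "Upper ?L I \<subseteq> idempotents A" by (auto simp: Upper_def carrier)
  then obtain i where i: "greatest ?L i (Lower ?L (Upper ?L I))" using ex_greatest_Lower by blast
  have "i \<in> Upper ?L I"
    using i I unfolding greatest_def Lower_def Upper_def carrier by blast
  moreover have "i \<sqsubseteq>\<^bsub>?L\<^esub> u" if "u \<in> Upper ?L I" for u
    using i that unfolding greatest_def Lower_def Upper_def by blast
  ultimately show ?thesis by (auto simp: least_def Upper_def)
qed

end

theorem theorem7:
  fixes A :: "('g::{topological_group_add, t2_space} \<Rightarrow> complex) set"
  assumes "compact (UNIV :: 'g set)"
    and "invariant_algebra A"
  shows "bounded_complete_lattice (idempotent_order A) \<and>
    (\<forall>I\<subseteq>idempotents A.
       (\<exists>!s. least (idempotent_order A) s (Upper (idempotent_order A) I)) \<and>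
       (\<exists>!i. greatest (idempotent_order A) i (Lower (idempotent_order A) I))) \<and>
    (\<exists>\<epsilon>. least (idempotent_order A) \<epsilon> (idempotents A) \<and> \<epsilon> \<in> semigroup_centre A)"
proof -
  interpret compact_invariant A using assms by unfold_locales
  let ?L = "idempotent_order A"
  interpret L: partial_order ?L by (rule partial_order_idempotents)
  have carrier: "carrier ?L = idempotents A" by (simp add: idempotent_order_def)
  have "\<exists>!s. least ?L s (Upper ?L I)" if "I \<subseteq> idempotents A" for I
    using ex_least_Upper[OF that] L.least_unique by blast
  moreover have "\<exists>!i. greatest ?L i (Lower ?L I)" if "I \<subseteq> idempotents A" for I
    using ex_greatest_Lower[OF that] L.greatest_unique by blast
  moreover have "bounded_complete_lattice ?L"
    unfolding bounded_complete_lattice_def carrier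
    using ex_least_Upper ex_greatest_Lower partial_order_idempotents by blast
  moreover have "\<exists>\<epsilon>. least ?L \<epsilon> (idempotents A) \<and> \<epsilon> \<in> semigroup_centre A"
  proof -
    obtain e where e: "e \<in> idempotents A" "\<forall>j\<in>idempotents A. e \<star> j = e \<and> j \<star> e = e"
      using ex_infimum[of "idempotents A"] by blast
    then have "least ?L e (idempotents A)" by (simp add: least_def idempotent_order_def)
    moreover have "e \<in> semigroup_centre A" using e by (intro least_idempotent_central) auto
    ultimately show ?thesis by blast
  qed
  ultimately show ?thesis by blast
qed

end
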